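(* Let $G\in\mathcal{G}_{n,m}$ and let $G^*$ be its core. Then $G$ is structurally averaged controllable if and only if $G$ is accessible and the row-column bipartite graph $\mathscr{B}(\mathcal{S}_{G^*})$ has a row-saturating matching.
   Context: Ensemble setting. $\Sigma$ is a manifold, possibly with boundary, of dimension $d\ge 1$, and $\mu$ is a Borel probability measure on $\Sigma$. There exists a nonempty open set $\mathcal{O}\subseteq\operatorname{supp}\mu$ such that $\mu|_{\mathcal O}$ is absolutely continuous with respect to a smooth volume measure on $\mathcal O$. For bounded measurable functions $A:\Sigma\to\mathbb{R}^{n\times n}$, $B:\Sigma\to\mathbb{R}^{n\times m}$, consider the ensemble system $\frac{\partial}{\partial t}x(t,\sigma)=A(\sigma)x(t,\sigma)+B(\sigma)u(t)$, $\sigma\in\Sigma$, with $x(t,\sigma)\in\mathbb{R}^n$ and a common control $u(t)\in\mathbb{R}^m$ (not depending on $\sigma$). A control is admissible if $u:[0,T]\to\mathbb{R}^m$ is integrable for every $T>0$. The pair $(A,B)$ is averaged controllable if for every initial profile $x(0,\cdot)\in L^\infty(\Sigma;\mathbb{R}^n)$, every $x^*\in\mathbb{R}^n$ and every $T>0$ there is an admissible control $u$ such that the solution satisfies $\int_\Sigma x(T,\sigma)\,d\mu=x^*$. (Known fact: this holds if and only if the infinite block matrix $\left[\int_\Sigma B\,d\mu,\int_\Sigma AB\,d\mu,\int_\Sigma A^2B\,d\mu,\dots\right]$ has rank $n$.) Graphs. $\mathcal{G}_{n,m}$ is the set of digraphs $G=(V,E)$ (self-loops allowed) whose node set is the disjoint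 union of $V_\alpha=\{\alpha_1,\dots,\alpha_n\}$ (state nodes) and $V_\beta=\{\beta_1,\dots,\beta_m\}$ (input nodes), such that no $\beta$-node has an in-neighbor. A pair $(A,B)\in L^\infty(\Sigma;\mathbb{R}^{n\times n})\times L^\infty(\Sigma;\mathbb{R}^{n\times m})$ is compliant with $G$ if $A_{jk}$ is the zero function whenever $\alpha_k\alpha_j\notin E$ and $B_{ji}$ is the zero function whenever $\beta_i\alpha_j\notin E$, where $uv$ denotes the directed edge from $u$ to $v$. $G$ is structurally averaged controllable if there exists an averaged controllable pair compliant with $G$. $G$ is accessible if for every $\alpha$-node $\alpha_j$ there is some $\beta_i$ and a directed path from $\beta_i$ to $\alpha_j$. Core. A self-loop counts as a cycle. A strong component is nontrivial if it contains a cycle. $V_{\mathrm{cyc}}$ is the set of nodes in nontrivial strong components of $G$, and $V_{\mathrm{cyc}}^+$ is $V_{\mathrm{cyc}}$ together with all nodes reachable by a directed path from a node of $V_{\mathrm{cyc}}$. The core $G^*$ of $G$ is the subgraph induced by $V^*:=V\setminus V_{\mathrm{cyc}}^+$; it is acyclic and contains all $\beta$-nodes. Let $n^*:=|V^*\cap V_\alpha|$ and label the $\alpha$-nodes of $G^*$ as $\alpha_1,\dots,\alpha_{n^*}$. Sparsity pattern. $\mathcal{S}_{G^*}\in\{0,\ast\}^{n^*\times mn^*}$ is the pattern with $(\mathcal{S}_{G^*})_{h,(k-1)m+i}=\ast$ if there is a path of length $k$ (i.e. with $k$ edges) from $\beta_i$ to $\alpha_h$ in $G^*$, and $0$ otherwise,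 for $h,k\in\{1,\dots,n^*\}$, $i\in\{1,\dots,m\}$. Bipartite graph. For a pattern $\mathcal{S}\in\{0,\ast\}^{r\times s}$, $\mathscr{B}(\mathcal{S})$ is the bipartite graph with one node for each row and one node for each column, with an edge between row $i$ and column $j$ if and only if $\mathcal{S}_{ij}=\ast$. A matching is row-saturating if every row node is incident to exactly one edge of the matching. If $n^*=0$ there are no row nodes and the matching condition holds trivially. *)

theory Defs
  imports
    "HOL-Probability.Probability"
    "Graph_Theory.Digraph_Component"
    "Graph_Theory.Pair_Digraph"
begin

subsection \<open>Smooth manifolds with boundary\<close>

text \<open>\<open>Ck_on k f S\<close> is meant for open \<open>S\<close> in a finite-dimensional space, where continuity of all
  iterated directional derivatives up to order \<open>k\<close> is the usual notion of class \<open>C^k\<close>.\<close>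

primrec Ck_on :: "nat \<Rightarrow> ('v::real_normed_vector \<Rightarrow> 'w::real_normed_vector) \<Rightarrow> 'v set \<Rightarrow> bool" where
  "Ck_on 0 f S \<longleftrightarrow> continuous_on S f"
| "Ck_on (Suc k) f S \<longleftrightarrow>
     (\<forall>x\<in>S. f differentiable (at x)) \<and> (\<forall>v. Ck_on k (\<lambda>x. frechet_derivative f (at x) v) S)"

text \<open>Smoothness on a set that need not be open (such as a relatively open subset of a half-space)
  means local extendability to a smooth function on an open set.\<close>

definition smooth_on :: "('v::real_normed_vector \<Rightarrow> 'w::real_normed_vector) \<Rightarrow> 'v set \<Rightarrow> bool" where
  "smooth_on f S \<longleftrightarrow>
     (\<forall>x\<in>S. \<exists>U g. open U \<and> x \<in> U \<and> (\<forall>k. Ck_on k g U) \<and> (\<forall>y\<in>U \<inter> S. g y = f y))"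

text \<open>A chart \<open>(U, \<phi>)\<close> has its image open either in \<open>\<real>^d\<close> or in a closed coordinate half-space
  (where the chart may meet the boundary), \<open>d = CARD('d) \<ge> 1\<close>.
  The manifold is the whole type \<open>'a\<close>; being Hausdorff and second countable is left to its
  type class constraints.\<close>

definition is_chart :: "'a::topological_space set \<times> ('a \<Rightarrow> real ^ 'd) \<Rightarrow> bool" where
  "is_chart = (\<lambda>(U, \<phi>).
     open U \<and> (\<exists>\<psi>. homeomorphism U (\<phi> ` U) \<phi> \<psi>) \<and>
     (open (\<phi> ` U) \<or> (\<exists>k. openin (top_of_set {x. 0 \<le> x $ k}) (\<phi> ` U))))"

definition smooth_atlas :: "('a::topological_space set \<times> ('a \<Rightarrow> real ^ 'd)) set \<Rightarrow> bool" where
  "smooth_atlas \<A> \<longleftrightarrow>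
     (\<forall>c\<in>\<A>. is_chart c) \<and> (\<Union>c\<in>\<A>. fst c) = UNIV \<and>
     (\<forall>(U, \<phi>)\<in>\<A>. \<forall>(U', \<phi>')\<in>\<A>. smooth_on (\<phi>' \<circ> inv_into U \<phi>) (\<phi> ` (U \<inter> U')))"

text \<open>A smooth volume measure on the open set \<open>W\<close>: in each chart it is given by a smooth positive
  density with respect to Lebesgue measure.\<close>

definition smooth_volume_measure ::
  "('a::topological_space set \<times> ('a \<Rightarrow> real ^ 'd)) set \<Rightarrow> 'a set \<Rightarrow> 'a measure \<Rightarrow> bool" where
  "smooth_volume_measure \<A> W \<nu> \<longleftrightarrow>
     space \<nu> = W \<and> sets \<nu> = sets (restrict_space borel W) \<and>
     (\<forall>(U, \<phi>)\<in>\<A>. \<exists>\<rho> :: real ^ 'd \<Rightarrow> real.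
        smooth_on \<rho> (\<phi> ` (U \<inter> W)) \<and> (\<forall>y\<in>\<phi> ` (U \<inter> W). 0 < \<rho> y) \<and>
        distr (restrict_space \<nu> (U \<inter> W)) borel \<phi> =
          density lborel (\<lambda>y. ennreal (\<rho> y) * indicator (\<phi> ` (U \<inter> W)) y))"

definition measure_support :: "'a::topological_space measure \<Rightarrow> 'a set" where
  "measure_support M = {x. \<forall>U. open U \<and> x \<in> U \<longrightarrow> 0 < emeasure M U}"


subsection \<open>Averaged controllability of ensemble systems\<close>

text \<open>Elements of \<open>L^\<infinity>\<close> are represented by functions; equality in \<open>L^\<infinity>\<close> is equality a.e.\<close>

definition Linfty :: "'a measure \<Rightarrow> ('a \<Rightarrow> 'v::real_normed_vector) set" where
  "Linfty M = {f. f \<in> borel_measurable M \<and> (\<exists>C. AE \<sigma> in M. norm (f \<sigma>) \<le> C)}"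

definition admissible_control :: "(real \<Rightarrow> real ^ 'm) \<Rightarrow> bool" where
  "admissible_control u \<longleftrightarrow> (\<forall>T>0. u absolutely_integrable_on {0..T})"

text \<open>Since controls are merely integrable, solutions are understood in the sense of
  Caratheodory, that is, as solutions of the integral equation. They are unique for given data.\<close>

definition ensemble_solution ::
  "('a \<Rightarrow> real ^ 'n ^ 'n) \<Rightarrow> ('a \<Rightarrow> real ^ 'm ^ 'n) \<Rightarrow> (real \<Rightarrow> real ^ 'm) \<Rightarrow>
   ('a \<Rightarrow> real ^ 'n) \<Rightarrow> (real \<Rightarrow> 'a \<Rightarrow> real ^ 'n) \<Rightarrow> bool" where
  "ensemble_solution A B u x0 x \<longleftrightarrow>
     (\<forall>\<sigma>. \<forall>t\<ge>0. (\<lambda>s. A \<sigma> *v x s \<sigma> + B \<sigma> *v u s) absolutely_integrable_on {0..t} \<and>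
        x t \<sigma> = x0 \<sigma> + integral {0..t} (\<lambda>s. A \<sigma> *v x s \<sigma> + B \<sigma> *v u s))"

definition averaged_controllable ::
  "'a measure \<Rightarrow> ('a \<Rightarrow> real ^ 'n ^ 'n) \<Rightarrow> ('a \<Rightarrow> real ^ 'm ^ 'n) \<Rightarrow> bool" where
  "averaged_controllable \<mu> A B \<longleftrightarrow>
     (\<forall>x0\<in>Linfty \<mu>. \<forall>xstar. \<forall>T>0. \<exists>u x.
        admissible_control u \<and> ensemble_solution A B u x0 x \<and>
        has_bochner_integral \<mu> (x T) xstar)"


subsection \<open>Digraphs on state and input nodes\<close>

datatype ('n, 'm) node = State 'n | Input 'm

definition control_digraphs :: "('n, 'm) node pair_pre_digraph set" where
  "control_digraphs = {G. pverts G = UNIV \<and> (\<forall>u i. (u, Input i) \<notin> parcs G)}"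

definition compliant ::
  "'a measure \<Rightarrow> ('n, 'm) node pair_pre_digraph \<Rightarrow>
   ('a \<Rightarrow> real ^ 'n ^ 'n) \<Rightarrow> ('a \<Rightarrow> real ^ 'm ^ 'n) \<Rightarrow> bool" where
  "compliant \<mu> G A B \<longleftrightarrow>
     A \<in> Linfty \<mu> \<and> B \<in> Linfty \<mu> \<and>
     (\<forall>j k. (State k, State j) \<notin> parcs G \<longrightarrow> (AE \<sigma> in \<mu>. A \<sigma> $ j $ k = 0)) \<and>
     (\<forall>j i. (Input i, State j) \<notin> parcs G \<longrightarrow> (AE \<sigma> in \<mu>. B \<sigma> $ j $ i = 0))"

definition structurally_averaged_controllable ::
  "'a measure \<Rightarrow> ('n::finite, 'm::finite) node pair_pre_digraph \<Rightarrow> bool" where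
  "structurally_averaged_controllable \<mu> G \<longleftrightarrow>
     (\<exists>A B. compliant \<mu> G A B \<and> averaged_controllable \<mu> A B)"

definition accessible :: "('n, 'm) node pair_pre_digraph \<Rightarrow> bool" where
  "accessible G \<longleftrightarrow> (\<forall>j. \<exists>i p. pre_digraph.apath (with_proj G) (Input i) p (State j))"


subsection \<open>The core and its sparsity pattern\<close>

text \<open>The library's \<^const>\<open>pre_digraph.cycle\<close> includes self-loops.\<close>

definition Vcyc :: "'v pair_pre_digraph \<Rightarrow> 'v set" where
  "Vcyc G = \<Union> {verts H |H. H \<in> pre_digraph.sccs (with_proj G) \<and> (\<exists>p. pre_digraph.cycle H p)}"

definition Vcyc_plus :: "'v pair_pre_digraph \<Rightarrow> 'v set" where
  "Vcyc_plus G = Vcyc G \<union> {v. \<exists>u\<in>Vcyc G. u \<rightarrow>\<^sup>*\<^bsub>with_proj G\<^esub> v}"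

definition core :: "'v pair_pre_digraph \<Rightarrow> ('v, 'v \<times> 'v) pre_digraph" where
  "core G = with_proj G \<restriction> (pverts G - Vcyc_plus G)"

definition core_states :: "('n, 'm) node pair_pre_digraph \<Rightarrow> 'n set" where
  "core_states G = {h. State h \<in> verts (core G)}"

definition nstar :: "('n, 'm) node pair_pre_digraph \<Rightarrow> nat" where
  "nstar G = card (core_states G)"

datatype pattern_entry = Zero | Star

text \<open>Rows are indexed by the state nodes of the core themselves and columns by pairs
  \<open>(k, i)\<close> with \<open>k \<in> {1..n\<^sup>*}\<close> and \<open>i\<close> an input; in the numbering
  of states by \<open>{1..n\<^sup>*}\<close> and inputs by \<open>{1..m}\<close>, the pair \<open>(k, i)\<close> is
  column \<open>(k - 1) m + i\<close>.\<close>

definition sparsity_pattern ::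
  "('n, 'm) node pair_pre_digraph \<Rightarrow> 'n \<Rightarrow> nat \<times> 'm \<Rightarrow> pattern_entry" where
  "sparsity_pattern G = (\<lambda>h (k, i).
     if \<exists>p. pre_digraph.apath (core G) (Input i) p (State h) \<and> length p = k then Star else Zero)"

definition pattern_rows :: "('n, 'm) node pair_pre_digraph \<Rightarrow> 'n set" where
  "pattern_rows G = core_states G"

definition pattern_columns :: "('n, 'm) node pair_pre_digraph \<Rightarrow> (nat \<times> 'm) set" where
  "pattern_columns G = {1..nstar G} \<times> UNIV"


subsection \<open>Row-column bipartite graphs and matchings\<close>

text \<open>The undirected edges of the bipartite graph of a pattern with row index set \<open>R\<close> and column
  index set \<open>C\<close>; row nodes are tagged by \<^const>\<open>Inl\<close>, column nodes by \<^const>\<open>Inr\<close>.\<close>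

definition bipartite_edges ::
  "'r set \<Rightarrow> 'c set \<Rightarrow> ('r \<Rightarrow> 'c \<Rightarrow> pattern_entry) \<Rightarrow> ('r + 'c) set set" where
  "bipartite_edges R C S = {{Inl i, Inr j} |i j. i \<in> R \<and> j \<in> C \<and> S i j = Star}"

definition is_matching :: "'v set set \<Rightarrow> 'v set set \<Rightarrow> bool" where
  "is_matching E M \<longleftrightarrow> M \<subseteq> E \<and> (\<forall>e\<in>M. \<forall>f\<in>M. e \<noteq> f \<longrightarrow> e \<inter> f = {})"

definition has_row_saturating_matching ::
  "'r set \<Rightarrow> 'c set \<Rightarrow> ('r \<Rightarrow> 'c \<Rightarrow> pattern_entry) \<Rightarrow> bool" where
  "has_row_saturating_matching R C S \<longleftrightarrow>
     (\<exists>M. is_matching (bipartite_edges R C S) M \<and> (\<forall>i\<in>R. \<exists>!e. e \<in> M \<and> Inl i \<in> e))"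

end

theory Submission
  imports Defs
begin

text \<open>
  A pair \<open>(A, B)\<close> is averaged controllable iff the moments
  \<open>\<integral> A\<^sup>k B e\<^sub>i d\<mu>\<close> span the state space. Component \<open>j\<close> of such a moment vanishes
  unless there is a walk with \<open>k + 1\<close> edges from input \<open>i\<close> to state \<open>j\<close>. If the moments span,
  some square matrix of moments has a nonzero determinant, and a nonzero term of its Leibniz
  expansion assigns to every state a walk, with distinct pairs (length, input); restricted to the
  core this is the matching.

  Conversely, \<open>\<mu>\<close> has no atoms on \<open>W\<close>, so there are disjoint sets of positive measure, one for each
  state \<open>h\<close>. On the set of \<open>h\<close> the pair is \<open>z\<^sub>h\<close> times the 0/1 adjacency matrix of a subgraph: the
  matched path if \<open>h\<close> is in the core; otherwise a walk that runs to a nearest cyclic node, keeps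
  returning to it, and emits a shortest tail from there to \<open>h\<close>. If \<open>w\<close> annihilates all moments, widely separated
  gains \<open>z\<^sub>h\<close> make each set's contribution vanish for long walks, so \<open>w = 0\<close> outside the core by
  induction on the distance to the cyclic nodes. On the core the columns selected by the matching
  are diagonally dominant.
\<close>

section \<open>Walks with unambiguous layers\<close>

text \<open>The gains separate the pieces by growth rate: along walks of k edges the piece of
  \<open>h\<close> carries a factor \<open>z_h ^ k\<close>, and all gains are powers
  \<open>Z ^ r h\<close> of one large number, so in a vanishing combination the term of largest rank
  is controlled by the others. Two obstacles fix the construction. A core state is reached only by
  walks of bounded length, so no limit in k is available: each core state needs a column of its own.
  Shorter paths get larger gains, because at the length of a given path the shorter ones have died
  out and the longer ones must be negligible. A state outside the core needs arbitrarily long walks,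
  and the subgraph that keeps them alive may reach other states at the same time; a tail from a
  nearest cyclic node ensures that these bystanders are nearer to the cyclic nodes, so the induction
  has already dealt with them. The criterion by moments is itself derived: delayed ramp inputs give
  one direction, repeated integration of the state equation the other.\<close>

definition layer :: "('v \<times> 'v) set \<Rightarrow> 'v \<Rightarrow> nat \<Rightarrow> 'v set" where
  "layer F x k = (F ^^ k) `` {x}"

text \<open>By induction on k there is at most one walk of k edges from \<open>x\<close> to any
  node. \<open>F\<close> may still branch, and walks may merge as long as they do so at different
  times.\<close>

definition unambiguous :: "('v \<times> 'v) set \<Rightarrow> 'v \<Rightarrow> bool" where
  "unambiguous F x \<longleftrightarrow>
     (\<forall>k u u' v. u \<in> layer F x k \<longrightarrow> u' \<in> layer F x k \<longrightarrow> (u, v) \<in> F \<longrightarrow> (u', v) \<in> F \<longrightarrow> u = u')"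

lemma layer_0 [simp]: "layer F x 0 = {x}"
  by (simp add: layer_def)

lemma layer_Suc: "layer F x (Suc k) = F `` layer F x k"
  by (auto simp: layer_def)

text \<open>The value of \<open>LEAST\<close> is meaningful for nodes reachable from a cyclic node,
  and only such nodes are compared. Cyclic nodes have distance 0.\<close>

definition cyc_dist :: "('v \<times> 'v) set \<Rightarrow> 'v \<Rightarrow> nat" where
  "cyc_dist R v = (LEAST d. \<exists>c. (c, c) \<in> R\<^sup>+ \<and> (c, v) \<in> R ^^ d)"

lemma cyc_dist_le: "(c, c) \<in> R\<^sup>+ \<Longrightarrow> (c, v) \<in> R ^^ d \<Longrightarrow> cyc_dist R v \<le> d"
  unfolding cyc_dist_def by (rule Least_le) blast

lemma cyc_dist_attained:
  assumes "(c, c) \<in> R\<^sup>+" "(c, v) \<in> R\<^sup>*"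
  obtains c' where "(c', c') \<in> R\<^sup>+" "(c', v) \<in> R ^^ cyc_dist R v"
proof -
  from assms(2) obtain d where "(c, v) \<in> R ^^ d"
    using rtrancl_imp_relpow by blast
  with assms(1) have "\<exists>d c. (c, c) \<in> R\<^sup>+ \<and> (c, v) \<in> R ^^ d" by blast
  then have "\<exists>c. (c, c) \<in> R\<^sup>+ \<and> (c, v) \<in> R ^^ cyc_dist R v"
    unfolding cyc_dist_def by (rule LeastI_ex)
  with that show thesis by blast
qed

text \<open>A shorter approach to an intermediate node of a minimal walk could be spliced with the
  remaining edges and would reach \<open>v\<close> too early. The exact distances later make the
  tail injective and keep its nodes after the first from leading back to the start.\<close>

lemma shortest_tail:
  assumes "(c', c') \<in> R\<^sup>+" "(c', v) \<in> R\<^sup>*"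
  obtains t where "(t 0, t 0) \<in> R\<^sup>+" "t (cyc_dist R v) = v"
    "\<And>q. q < cyc_dist R v \<Longrightarrow> (t q, t (Suc q)) \<in> R"
    "\<And>q. q \<le> cyc_dist R v \<Longrightarrow> cyc_dist R (t q) = q"
proof -
  obtain c where c: "(c, c) \<in> R\<^sup>+" "(c, v) \<in> R ^^ cyc_dist R v"
    using assms by (rule cyc_dist_attained)
  obtain t where t: "t 0 = c" "t (cyc_dist R v) = v"
      "\<And>q. q < cyc_dist R v \<Longrightarrow> (t q, t (Suc q)) \<in> R"
    using c(2) unfolding relpow_fun_conv by blast
  have sub: "(t i, t j) \<in> R ^^ (j - i)" if "i \<le> j" "j \<le> cyc_dist R v" for i j
    unfolding relpow_fun_conv using that t(3)
    by (intro exI[of _ "\<lambda>q. t (q + i)"]) auto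
  have "cyc_dist R (t q) = q" if q: "q \<le> cyc_dist R v" for q
  proof (rule antisym)
    show "cyc_dist R (t q) \<le> q"
      using cyc_dist_le[OF c(1), of "t q" q] sub[of 0 q] q t(1) by simp
    have "(c, t q) \<in> R\<^sup>*"
      using sub[of 0 q] q t(1) by (auto intro: relpow_imp_rtrancl)
    then obtain c2 where c2: "(c2, c2) \<in> R\<^sup>+" "(c2, t q) \<in> R ^^ cyc_dist R (t q)"
      using c(1) cyc_dist_attained by metis
    have "(c2, v) \<in> R ^^ cyc_dist R (t q) O R ^^ (cyc_dist R v - q)"
      using c2(2) sub[of q "cyc_dist R v"] q t(2) by auto
    then have "(c2, v) \<in> R ^^ (cyc_dist R (t q) + (cyc_dist R v - q))"
      by (simp only: relpow_add)
    from cyc_dist_le[OF c2(1) this] q show "q \<le> cyc_dist R (t q)" by simp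
  qed
  with t c(1) that show thesis by metis
qed

text \<open>Each node that reaches \<open>c\<close> steps strictly closer to \<open>c\<close>,
  except that \<open>c\<close> itself steps to the next node of a closed walk. A function is wanted
  so that the circulating walk has exactly one position at each time.\<close>

lemma return_function:
  assumes c: "(c, c) \<in> R\<^sup>+"
  obtains f where "\<And>v. (v, c) \<in> R\<^sup>* \<Longrightarrow> (v, f v) \<in> R"
    "\<And>v. (v, c) \<in> R\<^sup>* \<Longrightarrow> (f v, c) \<in> R\<^sup>*"
    "\<And>v. (v, c) \<in> R\<^sup>* \<Longrightarrow> \<exists>j. (f ^^ j) v = c"
proof -
  define e where "e v = (LEAST d. (v, c) \<in> R ^^ d)" for v
  have e: "(v, c) \<in> R ^^ e v" if "(v, c) \<in> R\<^sup>*" for v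
    unfolding e_def using rtrancl_imp_relpow[OF that] by (auto intro: LeastI)
  have "\<exists>u. (v, u) \<in> R \<and> (u, c) \<in> R\<^sup>* \<and> (v \<noteq> c \<longrightarrow> e u < e v)" if v: "(v, c) \<in> R\<^sup>*" for v
  proof (cases "v = c")
    case True
    with c show ?thesis by (metis tranclD)
  next
    case False
    with e[OF v] obtain d where d: "e v = Suc d" by (cases "e v") auto
    with e[OF v] obtain u where u: "(v, u) \<in> R" "(u, c) \<in> R ^^ d"
      by (metis relpow_Suc_D2)
    then have "e u \<le> d" unfolding e_def by (auto intro: Least_le)
    with u d show ?thesis by (auto intro: relpow_imp_rtrancl)
  qed
  then obtain f where f: "\<And>v. (v, c) \<in> R\<^sup>* \<Longrightarrow> (v, f v) \<in> R \<and> (f v, c) \<in> R\<^sup>* \<and> (v \<noteq> c \<longrightarrow> e (f v) < e v)"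
    by metis
  have "\<exists>j. (f ^^ j) v = c" if "(v, c) \<in> R\<^sup>*" for v
    using that
  proof (induction "e v" arbitrary: v rule: less_induct)
    case less
    show ?case
    proof (cases "v = c")
      case True
      then show ?thesis by (intro exI[of _ 0]) simp
    next
      case False
      with f[OF less.prems] less.hyps[of "f v"] obtain j where "(f ^^ j) (f v) = c" by blast
      then show ?thesis by (intro exI[of _ "Suc j"]) (simp add: funpow_swap1)
    qed
  qed
  with f that show thesis by blast
qed

text \<open>From \<open>x\<close> the walk follows the successor function towards the cyclic node \<open>c\<close>
  nearest to \<open>v\<close>, circulating forever, and at each visit to \<open>c\<close> a token
  branches off along the shortest tail from \<open>c\<close> to \<open>v\<close>.\<close>

lemma recurrent_subgraph:
  assumes access: "\<And>c. (c, c) \<in> R\<^sup>+ \<Longrightarrow> \<exists>x\<in>X. (x, c) \<in> R\<^sup>*"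
    and v: "(c', c') \<in> R\<^sup>+" "(c', v) \<in> R\<^sup>*"
  obtains x F where "x \<in> X" "F \<subseteq> R" "unambiguous F x"
    "\<And>K. \<exists>k\<ge>K. v \<in> layer F x k \<and>
       (\<forall>u\<in>layer F x k. u \<noteq> v \<longrightarrow> (\<exists>c. (c, c) \<in> R\<^sup>+ \<and> (c, u) \<in> R\<^sup>*) \<and> cyc_dist R u < cyc_dist R v)"
proof -
  define \<delta> where "\<delta> = cyc_dist R v"
  obtain t where t: "(t 0, t 0) \<in> R\<^sup>+" "t \<delta> = v" "\<And>q. q < \<delta> \<Longrightarrow> (t q, t (Suc q)) \<in> R"
      "\<And>q. q \<le> \<delta> \<Longrightarrow> cyc_dist R (t q) = q"
    using shortest_tail[OF v] unfolding \<delta>_def by metis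
  define c where "c = t 0"
  have c: "(c, c) \<in> R\<^sup>+" using t(1) by (simp add: c_def)
  obtain f where f: "\<And>v. (v, c) \<in> R\<^sup>* \<Longrightarrow> (v, f v) \<in> R"
      "\<And>v. (v, c) \<in> R\<^sup>* \<Longrightarrow> (f v, c) \<in> R\<^sup>*"
      "\<And>v. (v, c) \<in> R\<^sup>* \<Longrightarrow> \<exists>j. (f ^^ j) v = c"
    using return_function[OF c] by metis
  obtain x where x: "x \<in> X" "(x, c) \<in> R\<^sup>*" using access[OF c] by blast
  define D where "D = {v. (v, c) \<in> R\<^sup>*}"
  define F where "F = {(u, f u) |u. u \<in> D} \<union> {(t q, t (Suc q)) |q. q < \<delta>}"
  define \<rho> where "\<rho> k = (f ^^ k) x" for k
  have \<rho>_D: "\<rho> k \<in> D" for k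
    by (induction k) (use x(2) f(2) in \<open>auto simp: \<rho>_def D_def\<close>)
  have tail: "(t i, t j) \<in> R ^^ (j - i)" if "i \<le> j" "j \<le> \<delta>" for i j
    unfolding relpow_fun_conv using that t(3)
    by (intro exI[of _ "\<lambda>q. t (q + i)"]) auto
  have tail0: "(c, t q) \<in> R\<^sup>*" if "q \<le> \<delta>" for q
    using tail[of 0 q] that by (auto simp: c_def intro: relpow_imp_rtrancl)
  have cyc0: "cyc_dist R u = 0" if "(u, u) \<in> R\<^sup>+" for u
    using cyc_dist_le[OF that, of u 0] by simp
  \<comment> \<open>A tail node beyond \<open>c\<close> that led back to \<open>c\<close> would be
    cyclic, hence at distance 0. So no tail edge ends in \<open>D\<close>, and the circulating and
    the branching edges do not interfere.\<close>
  have t_notin_D: "t q \<notin> D" if "1 \<le> q" "q \<le> \<delta>" for q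
  proof
    assume "t q \<in> D"
    then have "(t q, c) \<in> R\<^sup>*" by (simp add: D_def)
    with c tail0[OF that(2)] have "(t q, t q) \<in> R\<^sup>+"
      by (meson rtrancl_trancl_trancl trancl_rtrancl_trancl)
    from cyc0[OF this] t(4)[of q] that show False by simp
  qed
  have t_inj: "q = q'" if "t q = t q'" "q \<le> \<delta>" "q' \<le> \<delta>" for q q'
    using t(4) that by metis
  \<comment> \<open>At time k there are the one circulating node and possibly nodes of tails that
    left \<open>c\<close> at earlier visits.\<close>
  have lay: "layer F x k \<subseteq> insert (\<rho> k) {t q |q. 1 \<le> q \<and> q \<le> \<delta>}" for k
  proof (induction k)
    case 0
    then show ?case by (simp add: \<rho>_def)
  next
    case (Suc k)
    show ?case
    proof
      fix v assume "v \<in> layer F x (Suc k)"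
      then obtain u where u: "u \<in> layer F x k" "(u, v) \<in> F" by (auto simp: layer_Suc)
      show "v \<in> insert (\<rho> (Suc k)) {t q |q. 1 \<le> q \<and> q \<le> \<delta>}"
      proof (cases "u \<in> D \<and> v = f u")
        case True
        with u(1) Suc t_notin_D have "u = \<rho> k" by blast
        with True show ?thesis by (simp add: \<rho>_def)
      next
        case False
        with u(2) obtain q where "q < \<delta>" "v = t (Suc q)" unfolding F_def by blast
        then show ?thesis by (intro insertI2) (auto intro!: exI[of _ "Suc q"])
      qed
    qed
  qed
  have FR: "F \<subseteq> R" using f(1) t(3) by (auto simp: F_def D_def)
  have "unambiguous F x"
    unfolding unambiguous_def
  proof (intro allI impI)
    fix k u u' v
    assume u: "u \<in> layer F x k" "u' \<in> layer F x k" "(u, v) \<in> F" "(u', v) \<in> F"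
    show "u = u'"
    proof (cases "v \<in> D")
      case True
      have "w = \<rho> k" if w: "w \<in> layer F x k" "(w, v) \<in> F" for w
      proof -
        have "w \<in> D"
          using w(2) True t_notin_D[of "Suc _"] unfolding F_def by (auto simp: Suc_le_eq)
        with lay[of k] w(1) t_notin_D show ?thesis by blast
      qed
      with u show ?thesis by metis
    next
      case False
      have "\<exists>q<\<delta>. w = t q \<and> v = t (Suc q)" if w: "(w, v) \<in> F" for w
        using w False f(2) unfolding F_def by (auto simp: D_def)
      with u obtain q q' where "q < \<delta>" "u = t q" "v = t (Suc q)" "q' < \<delta>" "u' = t q'" "v = t (Suc q')"
        by metis
      with t_inj[of "Suc q" "Suc q'"] show ?thesis by simp
    qed
  qed
  moreover
  have "\<exists>k\<ge>K. v \<in> layer F x k \<and>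
       (\<forall>u\<in>layer F x k. u \<noteq> v \<longrightarrow> (\<exists>c. (c, c) \<in> R\<^sup>+ \<and> (c, u) \<in> R\<^sup>*) \<and> cyc_dist R u < cyc_dist R v)" for K
  proof -
    obtain j where "(f ^^ j) (\<rho> K) = c" using f(3) \<rho>_D[of K] by (auto simp: D_def)
    then have j: "\<rho> (j + K) = c" by (simp add: \<rho>_def funpow_add)
    have \<rho>_layer: "\<rho> k \<in> layer F x k" for k
    proof (induction k)
      case (Suc k)
      then show ?case using \<rho>_D[of k] by (auto simp: layer_Suc F_def \<rho>_def)
    qed (simp add: \<rho>_def)
    have t_layer: "t q \<in> layer F x (j + K + q)" if "q \<le> \<delta>" for q
      using that
    proof (induction q)
      case 0
      then show ?case using \<rho>_layer[of "j + K"] j by (simp add: c_def)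
    next
      case (Suc q)
      then have "t q \<in> layer F x (j + K + q)" by simp
      moreover have "(t q, t (Suc q)) \<in> F" using Suc.prems by (auto simp: F_def)
      ultimately show ?case by (auto simp: layer_Suc)
    qed
    have "(c, \<rho> (j + K + q)) \<in> R ^^ q" for q
    proof (induction q)
      case (Suc q)
      have "(\<rho> (j + K + q), \<rho> (j + K + Suc q)) \<in> R"
        using f(1) \<rho>_D[of "j + K + q"] by (simp add: \<rho>_def D_def)
      with Suc show ?case by (auto intro: relcompI)
    qed (use j in simp)
    \<comment> \<open>Reached from \<open>c\<close> and leading back to it, the circulating node is
      itself cyclic and so has distance 0.\<close>
    then have \<rho>_cyc: "(\<rho> (j + K + \<delta>), \<rho> (j + K + \<delta>)) \<in> R\<^sup>+"
      using \<rho>_D[of "j + K + \<delta>"] c unfolding D_def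
      by (metis mem_Collect_eq relpow_imp_rtrancl rtrancl_trancl_trancl trancl_rtrancl_trancl)
    show ?thesis
    proof (intro exI[of _ "j + K + \<delta>"] conjI ballI impI)
      show "v \<in> layer F x (j + K + \<delta>)" using t_layer[of \<delta>] t(2) by simp
    next
      fix u assume u: "u \<in> layer F x (j + K + \<delta>)" "u \<noteq> v"
      have "(\<exists>c. (c, c) \<in> R\<^sup>+ \<and> (c, u) \<in> R\<^sup>*) \<and> cyc_dist R u < \<delta>"
      proof (cases "u = \<rho> (j + K + \<delta>)")
        case True
        \<comment> \<open>For distance 0 the tail is empty, and the circulating node at this time is
          \<open>c\<close>, which would then be \<open>v\<close>.\<close>
        have "\<delta> \<noteq> 0" using u(2) True j t(2) by (metis add_0_right c_def)
        then show ?thesis using \<rho>_cyc True cyc0[OF \<rho>_cyc] by auto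
      next
        case False
        with lay u(1) obtain q where q: "u = t q" "1 \<le> q" "q \<le> \<delta>" by blast
        with u(2) t(2) have "q < \<delta>" by (metis le_neq_implies_less)
        with q t(4) tail0 c show ?thesis by auto
      qed
      then show "\<exists>c. (c, c) \<in> R\<^sup>+ \<and> (c, u) \<in> R\<^sup>*" "cyc_dist R u < cyc_dist R v"
        by (auto simp: \<delta>_def)
    qed simp
  qed
  ultimately show thesis using that x(1) FR by blast
qed

text \<open>A repeated node on the walk would be cyclic and lead to \<open>v\<close>, so the walk is
  a simple path. Its own edges then have one node per layer and no continuation after k
  steps.\<close>

lemma path_subgraph:
  assumes w: "(x, v) \<in> R ^^ k" and acyc: "\<And>c. (c, c) \<in> R\<^sup>+ \<Longrightarrow> (c, v) \<notin> R\<^sup>*"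
  obtains F where "F \<subseteq> R" "unambiguous F x" "layer F x k = {v}" "\<And>j. k < j \<Longrightarrow> layer F x j = {}"
proof -
  obtain f where f: "f 0 = x" "f k = v" "\<And>i. i < k \<Longrightarrow> (f i, f (Suc i)) \<in> R"
    using w unfolding relpow_fun_conv by blast
  have sub: "(f i, f j) \<in> R ^^ (j - i)" if "i \<le> j" "j \<le> k" for i j
    unfolding relpow_fun_conv using that f(3)
    by (intro exI[of _ "\<lambda>q. f (q + i)"]) auto
  have less: "f i \<noteq> f j" if "i < j" "j \<le> k" for i j
  proof
    assume "f i = f j"
    with sub[of i j] that have "(f j, f j) \<in> R\<^sup>+"
      unfolding trancl_power by (intro exI[of _ "j - i"]) simp
    moreover have "(f j, v) \<in> R\<^sup>*" using sub[of j k] that f(2) by (auto intro: relpow_imp_rtrancl)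
    ultimately show False using acyc by blast
  qed
  then have inj: "i = j" if "f i = f j" "i \<le> k" "j \<le> k" for i j
    using that by (metis linorder_neqE_nat)
  define F where "F = {(f i, f (Suc i)) |i. i < k}"
  have lay: "layer F x j = (if j \<le> k then {f j} else {})" for j
  proof (induction j)
    case (Suc j)
    show ?case
    proof (cases "Suc j \<le> k")
      case True
      then have "F `` {f j} = {f (Suc j)}"
        unfolding F_def by (auto dest!: inj)
      with True Suc show ?thesis by (simp add: layer_Suc)
    next
      case False
      have "F `` {f k} = {}" unfolding F_def using inj by fastforce
      with False Suc show ?thesis by (cases "j = k") (auto simp: layer_Suc)
    qed
  qed (use f(1) in simp)
  show thesis
  proof (rule that[of F])
    show "F \<subseteq> R" using f(3) by (auto simp: F_def)
    show "unambiguous F x" by (auto simp: unambiguous_def lay split: if_splits)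
    show "layer F x k = {v}" using lay[of k] f(2) by simp
    show "layer F x j = {}" if "k < j" for j using lay[of j] that by simp
  qed
qed

section \<open>The core\<close>

lemma awalk_imp_relpow:
  assumes "pre_digraph.awalk H u p v" "arcs H \<subseteq> R" "tail H = fst" "head H = snd"
  shows "(u, v) \<in> R ^^ length p"
proof -
  have "pre_digraph.cas H u p v" "set p \<subseteq> arcs H"
    using assms(1) by (auto simp: pre_digraph.awalk_def)
  then show ?thesis
  proof (induction p arbitrary: u)
    case Nil
    then show ?case by (simp add: pre_digraph.cas.simps)
  next
    case (Cons e p)
    with assms have "(u, snd e) \<in> R" "(snd e, v) \<in> R ^^ length p"
      by (auto simp: pre_digraph.cas.simps)
    then show ?case unfolding length_Cons by (rule relpow_Suc_I2)
  qed
qed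

context
  fixes G :: "('n, 'm) node pair_pre_digraph"
  assumes G: "G \<in> control_digraphs"
begin

lemma wf_with_proj: "wf_digraph (with_proj G)"
  using G by unfold_locales (auto simp: control_digraphs_def)

lemma reachable_iff: "u \<rightarrow>\<^sup>*\<^bsub>with_proj G\<^esub> v \<longleftrightarrow> (u, v) \<in> (parcs G)\<^sup>*"
  using wf_digraph.reachable_conv[OF wf_with_proj] G by (auto simp: control_digraphs_def)

lemma accessible_iff: "accessible G \<longleftrightarrow> (\<forall>j. \<exists>i. (Input i, State j) \<in> (parcs G)\<^sup>*)"
  unfolding accessible_def reachable_iff[symmetric] wf_digraph.reachable_apath[OF wf_with_proj] ..

text \<open>A cycle in a strong component can be joined by walks to each node of the component.
  Conversely the first arc of a closed walk at \<open>v\<close> lies in the component of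
  \<open>v\<close>, where strong connectivity provides a way back.\<close>

lemma Vcyc_iff: "v \<in> Vcyc G \<longleftrightarrow> (v, v) \<in> (parcs G)\<^sup>+"
proof
  interpret wf_digraph "with_proj G" by (rule wf_with_proj)
  assume "v \<in> Vcyc G"
  then obtain H p where H: "H \<in> sccs" "v \<in> verts H" "pre_digraph.cycle H p"
    by (auto simp: Vcyc_def)
  then have sub: "subgraph H (with_proj G)" by (meson in_sccs_imp_induced induced_imp_subgraph)
  interpret H: wf_digraph H using sub by (simp add: subgraph_def)
  from H(3) obtain u where u: "H.awalk u p u" "p \<noteq> []" by (auto simp: H.cycle_def)
  have uH: "u \<in> verts H" using u(1) by (simp add: H.awalk_def)
  have sc: "strongly_connected H" using H(1) by auto
  then have "v \<rightarrow>\<^sup>*\<^bsub>H\<^esub> u" "u \<rightarrow>\<^sup>*\<^bsub>H\<^esub> v" using uH H(2) by (auto simp: strongly_connected_def)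
  then have "v \<rightarrow>\<^sup>*\<^bsub>with_proj G\<^esub> u" "u \<rightarrow>\<^sup>*\<^bsub>with_proj G\<^esub> v"
    using sub reachable_mono by blast+
  moreover have "u \<rightarrow>\<^sup>+\<^bsub>with_proj G\<^esub> u"
    using subgraph_awalk_imp_awalk[OF u(1) sub] u(2) by (rule reachable1_awalkI)
  ultimately have "v \<rightarrow>\<^sup>+\<^bsub>with_proj G\<^esub> v"
    by (metis reachable1_reachable_trans reachable_reachable1_trans)
  then show "(v, v) \<in> (parcs G)\<^sup>+" by simp
next
  interpret wf_digraph "with_proj G" by (rule wf_with_proj)
  assume v: "(v, v) \<in> (parcs G)\<^sup>+"
  define H where "H = with_proj G \<restriction> scc_of v"
  interpret H: wf_digraph H unfolding H_def by (rule wellformed_induce_subgraph)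
  have vV: "v \<in> verts (with_proj G)" using G by (simp add: control_digraphs_def)
  have H: "H \<in> sccs" unfolding H_def using scc_of_in_sccs_verts[OF vV] by (simp add: in_sccs_verts_conv)
  have vH: "v \<in> verts H" using in_scc_of_self[OF vV] by (simp add: H_def)
  from v obtain u where u: "(v, u) \<in> parcs G" "(u, v) \<in> (parcs G)\<^sup>*" by (meson tranclD)
  have uH: "u \<in> verts H"
    using u by (auto simp: H_def scc_of_def reachable_iff)
  have "(v, u) \<in> arcs H" "tail H (v, u) = v" "head H (v, u) = u"
    using u(1) vH uH by (auto simp: H_def induce_subgraph_def)
  then have "v \<rightarrow>\<^bsub>H\<^esub> u" by (metis H.in_arcs_imp_in_arcs_ends)
  moreover have "u \<rightarrow>\<^sup>*\<^bsub>H\<^esub> v"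
    using H uH vH by (auto simp: strongly_connected_def)
  ultimately have "v \<rightarrow>\<^sup>+\<^bsub>H\<^esub> v" by (metis H.reachable1_reachable_trans trancl.r_into_trancl)
  then obtain p where "H.awalk v p v" "p \<noteq> []" by (auto simp: H.reachable1_awalk)
  then have "\<exists>p. H.cycle p" by (intro H.closed_w_imp_cycle[of p]) (auto simp: H.closed_w_def)
  with H vH show "v \<in> Vcyc G" by (auto simp: Vcyc_def)
qed

lemma core_states_iff:
  "h \<in> core_states G \<longleftrightarrow> (\<nexists>c. (c, c) \<in> (parcs G)\<^sup>+ \<and> (c, State h) \<in> (parcs G)\<^sup>*)"
  using G unfolding core_states_def core_def Vcyc_plus_def
  by (auto simp: Vcyc_iff reachable_iff control_digraphs_def)

lemma apath_core_imp_relpow: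
  assumes "pre_digraph.apath (core G) u p v"
  shows "(u, v) \<in> parcs G ^^ length p"
  using assms
  by (intro awalk_imp_relpow[of "core G"]) (auto simp: pre_digraph.apath_def core_def induce_subgraph_def)

text \<open>A node on the walk that is reachable from a cyclic node would make \<open>v\<close> so
  as well, and a repeated node would be cyclic. Hence walks into the core stay in the core and are
  paths, which lets the pattern, defined by paths, be compared with moments, which see
  walks.\<close>

lemma relpow_imp_apath_core:
  assumes "(u, v) \<in> parcs G ^^ k" "\<nexists>c. (c, c) \<in> (parcs G)\<^sup>+ \<and> (c, v) \<in> (parcs G)\<^sup>*"
  shows "\<exists>p. pre_digraph.apath (core G) u p v \<and> length p = k"
  using assms(1)
proof (induction k arbitrary: u)
  interpret wf_digraph "with_proj G" by (rule wf_with_proj)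
  interpret C: wf_digraph "core G" unfolding core_def by (rule wellformed_induce_subgraph)
  have core: "u \<in> verts (core G) \<longleftrightarrow> (\<nexists>c. (c, c) \<in> (parcs G)\<^sup>+ \<and> (c, u) \<in> (parcs G)\<^sup>*)" for u
    using G unfolding core_def Vcyc_plus_def
    by (auto simp: Vcyc_iff reachable_iff control_digraphs_def)
  {
    case 0
    then show ?case using assms(2) core[of v]
      by (intro exI[of _ "[]"]) (simp add: C.apath_def C.awalk_def)
  next
    case (Suc k)
    from Suc.prems obtain y where y: "(u, y) \<in> parcs G" "(y, v) \<in> parcs G ^^ k"
      by (metis relpow_Suc_D2)
    obtain p where p: "C.apath y p v" "length p = k" using Suc.IH[OF y(2)] by blast
    have "(y, v) \<in> (parcs G)\<^sup>*" using y(2) by (rule relpow_imp_rtrancl)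
    then have yv: "y \<in> verts (core G)" and uv: "u \<in> verts (core G)" and uu: "(u, u) \<notin> (parcs G)\<^sup>+"
      unfolding core using assms(2) y(1) by (meson converse_rtrancl_into_rtrancl rtrancl_trans)+
    have "u \<notin> set (C.awalk_verts y p)"
    proof
      assume "u \<in> set (C.awalk_verts y p)"
      then obtain q where "C.awalk y q u"
        using p(1) by (meson C.apath_def C.awalk_decomp)
      then have "(y, u) \<in> parcs G ^^ length q"
        by (rule awalk_imp_relpow) (auto simp: core_def induce_subgraph_def)
      with y(1) uu show False by (meson relpow_imp_rtrancl rtrancl_into_trancl2)
    qed
    then have "C.apath u ((u, y) # p) v"
      unfolding C.apath_Cons_iff using y(1) p(1) uv yv by (auto simp: core_def induce_subgraph_def)
    with p(2) show ?case by (metis length_Cons)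
  }
qed

lemma sparsity_pattern_iff:
  assumes "h \<in> core_states G"
  shows "sparsity_pattern G h (k, i) = Star \<longleftrightarrow> (Input i, State h) \<in> parcs G ^^ k"
  using assms relpow_imp_apath_core[of "Input i" "State h" k] apath_core_imp_relpow
  unfolding sparsity_pattern_def core_states_iff by (auto 4 4)

text \<open>The state nodes on a walk into the core are distinct core nodes, which bounds its length.\<close>

lemma core_walk_length:
  fixes h :: 'n
  assumes fin: "finite (UNIV :: 'n set)"
    and h: "h \<in> core_states G" and w: "(Input i, State h) \<in> parcs G ^^ k"
  shows "1 \<le> k" "k \<le> nstar G"
proof -
  have acyc: "\<nexists>c. (c, c) \<in> (parcs G)\<^sup>+ \<and> (c, State h) \<in> (parcs G)\<^sup>*"
    using h by (simp add: core_states_iff)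
  show "1 \<le> k" using w by (cases k) auto
  obtain f where f: "f 0 = Input i" "f k = State h" "\<And>q. q < k \<Longrightarrow> (f q, f (Suc q)) \<in> parcs G"
    using w unfolding relpow_fun_conv by blast
  have sub: "(f a, f b) \<in> parcs G ^^ (b - a)" if "a \<le> b" "b \<le> k" for a b
    unfolding relpow_fun_conv using that f(3)
    by (intro exI[of _ "\<lambda>q. f (q + a)"]) auto
  have to_h: "(f a, State h) \<in> (parcs G)\<^sup>*" if "a \<le> k" for a
    using sub[of a k] that f(2) by (auto intro: relpow_imp_rtrancl)
  have "f a \<noteq> f b" if "a < b" "b \<le> k" for a b
  proof
    assume "f a = f b"
    with sub[of a b] that have "(f b, f b) \<in> (parcs G)\<^sup>+"
      unfolding trancl_power by (intro exI[of _ "b - a"]) simp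
    with to_h[OF that(2)] acyc show False by blast
  qed
  then have inj: "inj_on f {1..k}" by (intro linorder_inj_onI) auto
  have st: "\<exists>j. f q = State j" if q: "q \<in> {1..k}" for q
  proof -
    have "(f (q - 1), f q) \<in> parcs G" using f(3)[of "q - 1"] q by (cases q) auto
    then show ?thesis using G by (cases "f q") (auto simp: control_digraphs_def)
  qed
  have "f ` {1..k} \<subseteq> State ` core_states G"
  proof
    fix v assume "v \<in> f ` {1..k}"
    then obtain q where q: "q \<in> {1..k}" "v = f q" by blast
    obtain j where j: "f q = State j" using st[OF q(1)] by blast
    have "j \<in> core_states G"
      unfolding core_states_iff using acyc to_h[of q] q(1) j by (metis atLeastAtMost_iff rtrancl_trans)
    with q j show "v \<in> State ` core_states G" by simp
  qed
  moreover have fc: "finite (core_states G)" using fin by (rule finite_subset[rotated]) simp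
  ultimately have "card (f ` {1..k}) \<le> card (core_states G)"
    by (metis card_image_le card_mono finite_imageI le_trans)
  then show "k \<le> nstar G" using card_image[OF inj] by (simp add: nstar_def)
qed

text \<open>A row-saturating matching amounts to an injective choice of columns. The bound on the
  column lengths does not appear on the right because every walk into the core satisfies it.\<close>

lemma row_saturating_matching_iff:
  assumes fin: "finite (UNIV :: 'n set)"
  shows "has_row_saturating_matching (pattern_rows G) (pattern_columns G) (sparsity_pattern G) \<longleftrightarrow>
    (\<exists>c. inj_on c (core_states G) \<and>
       (\<forall>h\<in>core_states G. (Input (snd (c h)), State h) \<in> parcs G ^^ fst (c h)))"
    (is "?L \<longleftrightarrow> ?R")
proof
  let ?E = "bipartite_edges (pattern_rows G) (pattern_columns G) (sparsity_pattern G)"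
  assume ?L
  then obtain M where M: "is_matching ?E M" "\<And>h. h \<in> core_states G \<Longrightarrow> \<exists>!e. e \<in> M \<and> Inl h \<in> e"
    unfolding has_row_saturating_matching_def pattern_rows_def by blast
  have "\<exists>c. {Inl h, Inr c} \<in> M \<and> (Input (snd c), State h) \<in> parcs G ^^ fst c"
    if h: "h \<in> core_states G" for h
  proof -
    obtain e where e: "e \<in> M" "Inl h \<in> e" using M(2)[OF h] by blast
    then have "e \<in> ?E" using M(1) by (auto simp: is_matching_def)
    with e(2) obtain c where c: "e = {Inl h, Inr c}" "sparsity_pattern G h c = Star"
      by (auto simp: bipartite_edges_def)
    with e(1) sparsity_pattern_iff[OF h, of "fst c" "snd c"] show ?thesis
      by (intro exI[of _ c]) simp
  qed
  then obtain c where c: "\<And>h. h \<in> core_states G \<Longrightarrow> {Inl h, Inr (c h)} \<in> M"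
      "\<And>h. h \<in> core_states G \<Longrightarrow> (Input (snd (c h)), State h) \<in> parcs G ^^ fst (c h)"
    by metis
  have "inj_on c (core_states G)"
  proof (rule inj_onI)
    fix h h' assume h: "h \<in> core_states G" "h' \<in> core_states G" "c h = c h'"
    then have "{Inl h, Inr (c h)} \<inter> {Inl h', Inr (c h')} \<noteq> {}" by auto
    then have "{Inl h, Inr (c h)} = {Inl h', Inr (c h')}"
      using M(1) c(1) h(1,2) by (metis is_matching_def)
    then show "h = h'" by (auto simp: doubleton_eq_iff)
  qed
  with c(2) show ?R by blast
next
  assume ?R
  then obtain c where c: "inj_on c (core_states G)"
      "\<And>h. h \<in> core_states G \<Longrightarrow> (Input (snd (c h)), State h) \<in> parcs G ^^ fst (c h)"
    by blast
  define M where "M = (\<lambda>h. {Inl h, Inr (c h)}) ` core_states G"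
  have "is_matching (bipartite_edges (pattern_rows G) (pattern_columns G) (sparsity_pattern G)) M"
    unfolding is_matching_def
  proof (intro conjI ballI impI subsetI)
    fix e assume "e \<in> M"
    then obtain h where h: "h \<in> core_states G" "e = {Inl h, Inr (c h)}" by (auto simp: M_def)
    have "sparsity_pattern G h (c h) = Star"
      using sparsity_pattern_iff[OF h(1), of "fst (c h)" "snd (c h)"] c(2)[OF h(1)] by simp
    moreover have "c h \<in> pattern_columns G"
      using core_walk_length[OF fin h(1) c(2)[OF h(1)]]
      by (cases "c h") (auto simp: pattern_columns_def)
    ultimately show "e \<in> bipartite_edges (pattern_rows G) (pattern_columns G) (sparsity_pattern G)"
      using h unfolding bipartite_edges_def pattern_rows_def by blast
  next
    fix e e' assume "e \<in> M" "e' \<in> M" "e \<noteq> e'"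
    then show "e \<inter> e' = {}" using c(1) by (auto simp: M_def dest: inj_onD)
  qed
  moreover have "\<exists>!e. e \<in> M \<and> Inl h \<in> e" if "h \<in> core_states G" for h
    using that by (intro ex1I[of _ "{Inl h, Inr (c h)}"]) (auto simp: M_def)
  ultimately show ?L unfolding has_row_saturating_matching_def pattern_rows_def by blast
qed

end

section \<open>Solutions as exponential series\<close>

text \<open>The exponential generating function of \<open>a\<close>: differentiation becomes a shift
  of the coefficients, so that a linear differential equation is a recursion for
  \<open>a\<close>.\<close>

definition exp_series :: "(nat \<Rightarrow> 'v::real_normed_vector) \<Rightarrow> real \<Rightarrow> 'v" where
  "exp_series a t = (\<Sum>k. (t ^ k / fact k) *\<^sub>R a k)"

lemma summable_exp_bound: "summable (\<lambda>k. K * (c ^ k / fact k) :: real)"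
  using summable_exp[of c] by (intro summable_mult) (simp add: field_simps)

lemma exp_series_term_bound:
  fixes a :: "nat \<Rightarrow> 'v::real_normed_vector"
  assumes "norm (a k) \<le> D * C ^ k"
  shows "norm ((t ^ k / fact k) *\<^sub>R a k) \<le> D * ((\<bar>t\<bar> * C) ^ k / fact k)"
proof -
  have "norm ((t ^ k / fact k) *\<^sub>R a k) = \<bar>t\<bar> ^ k / fact k * norm (a k)"
    by (simp add: power_abs)
  also have "\<dots> \<le> \<bar>t\<bar> ^ k / fact k * (D * C ^ k)"
    by (intro mult_left_mono assms) auto
  finally show ?thesis by (simp add: power_mult_distrib mult_ac)
qed

lemma summable_exp_series:
  fixes a :: "nat \<Rightarrow> 'v::banach"
  assumes "\<And>k. norm (a k) \<le> D * C ^ k"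
  shows "summable (\<lambda>k. (t ^ k / fact k) *\<^sub>R a k)"
  using exp_series_term_bound[OF assms] summable_exp_bound
  by (rule summable_comparison_test'[rotated, where N = 0])

lemma bounded_linear_exp_series:
  fixes a :: "nat \<Rightarrow> 'v::banach"
  assumes f: "bounded_linear f" and a: "\<And>k. norm (a k) \<le> D * C ^ k"
  shows "f (exp_series a t) = exp_series (\<lambda>k. f (a k)) t"
  unfolding exp_series_def
  using bounded_linear.suminf[OF f summable_exp_series[OF a, of t]]
  by (simp add: linear_simps(5)[OF f])

lemma has_vector_derivative_exp_series:
  fixes a :: "nat \<Rightarrow> 'v::euclidean_space"
  assumes a: "\<And>k. norm (a k) \<le> D * C ^ k"
  shows "(exp_series a has_vector_derivative exp_series (\<lambda>k. a (Suc k)) t) (at t)"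
proof -
  have Suc_bound: "norm (a (Suc k)) \<le> (D * C) * C ^ k" for k
    using a[of "Suc k"] by (simp add: mult_ac)
  have comp: "exp_series b s \<bullet> i = (\<Sum>k. (b k \<bullet> i / fact k) * s ^ k)"
    if "\<And>k. norm (b k) \<le> D' * C ^ k" for b :: "nat \<Rightarrow> 'v" and s i D'
    using bounded_linear_exp_series[OF bounded_linear_inner_left[of i] that]
    by (simp add: exp_series_def mult_ac)
  have "((\<lambda>s. exp_series a s \<bullet> i) has_derivative (\<lambda>s. s * (exp_series (\<lambda>k. a (Suc k)) t \<bullet> i))) (at t)"
    for i
  proof -
    have sm: "summable (\<lambda>k. (a k \<bullet> i / fact k) * s ^ k)" for s
      using bounded_linear.summable[OF bounded_linear_inner_left[of i] summable_exp_series[OF a, of s]]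
      by (simp add: mult_ac)
    have diffs: "diffs (\<lambda>k. a k \<bullet> i / fact k) = (\<lambda>k. a (Suc k) \<bullet> i / fact k)"
      by (auto simp: diffs_def fun_eq_iff)
    have "((\<lambda>s. \<Sum>k. (a k \<bullet> i / fact k) * s ^ k) has_field_derivative
        (\<Sum>k. (a (Suc k) \<bullet> i / fact k) * t ^ k)) (at t)"
      using termdiffs_strong_converges_everywhere[OF sm, of t] by (simp add: diffs)
    then show ?thesis
      unfolding has_field_derivative_def comp[OF a] comp[of "\<lambda>k. a (Suc k)", OF Suc_bound]
      by (simp add: mult.commute[of _ "suminf _"])
  qed
  then show ?thesis
    unfolding has_vector_derivative_def has_derivative_componentwise_within[of "exp_series a"] by simp
qed

lemma exp_series_0: "exp_series a 0 = a 0"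
proof -
  have "(\<lambda>k. (0 ^ k / fact k) *\<^sub>R a k) = (\<lambda>k. if k = 0 then a k else 0)"
    by (auto simp: fun_eq_iff)
  then show ?thesis using sums_single[of 0 a] by (simp add: exp_series_def sums_iff)
qed

lemma bounded_bilinear_matrix_vector:
  "bounded_bilinear (\<lambda>(A :: real ^ 'n ^ 'm) x. A *v x)"
proof -
  have "bilinear (\<lambda>(A :: real ^ 'n ^ 'm) x. A *v x)"
    unfolding bilinear_def
    by (auto intro!: linearI simp: matrix_vector_mult_add_rdistrib vec.add
        scaleR_matrix_vector_assoc matrix_vector_mult_scaleR)
  then show ?thesis by (simp add: bilinear_conv_bounded_bilinear)
qed

lemma matrix_vector_bound:
  obtains \<kappa> where "0 < \<kappa>" "\<And>(A :: real ^ 'n ^ 'm) x. norm (A *v x) \<le> \<kappa> * norm A * norm x"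
proof -
  obtain \<kappa> where "0 < \<kappa>" "\<And>(A :: real ^ 'n ^ 'm) x. norm (A *v x) \<le> norm A * norm x * \<kappa>"
    using bounded_bilinear.pos_bounded[OF bounded_bilinear_matrix_vector] by blast
  then show thesis by (intro that[of \<kappa>]) (simp_all add: mult_ac)
qed

lemma matrix_iterate_bound:
  fixes A :: "real ^ 'n ^ 'n"
  assumes "\<And>x. norm (A *v x) \<le> C * norm x" "0 \<le> C"
  shows "norm (((*v) A ^^ k) v) \<le> norm v * C ^ k"
proof (induction k)
  case (Suc k)
  have "norm (A *v ((*v) A ^^ k) v) \<le> C * norm (((*v) A ^^ k) v)" by (rule assms)
  also have "\<dots> \<le> C * (norm v * C ^ k)" using Suc assms(2) by (rule mult_left_mono)
  finally show ?case by (simp add: mult_ac)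
qed simp

lemma linear_matrix_iterate: "linear ((*v) (A :: real ^ 'n ^ 'n) ^^ k)"
proof (induction k)
  case 0
  then show ?case by (simp add: linear_id[unfolded id_def])
next
  case (Suc k)
  have "linear ((*v) A \<circ> ((*v) A ^^ k))" by (rule linear_compose[OF Suc matrix_vector_mul_linear])
  then show ?case by (simp add: o_def)
qed

lemma measurable_matrix_vector [measurable]:
  fixes A :: "'a \<Rightarrow> real ^ 'n ^ 'm"
  assumes "A \<in> borel_measurable M" "g \<in> borel_measurable M"
  shows "(\<lambda>\<sigma>. A \<sigma> *v g \<sigma>) \<in> borel_measurable M"
  using assms
  by (rule borel_measurable_continuous_Pair)
    (intro bounded_bilinear.continuous_on[OF bounded_bilinear_matrix_vector] continuous_intros)

lemma measurable_matrix_iterate [measurable]: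
  fixes A :: "'a \<Rightarrow> real ^ 'n ^ 'n"
  assumes "A \<in> borel_measurable M" "g \<in> borel_measurable M"
  shows "(\<lambda>\<sigma>. ((*v) (A \<sigma>) ^^ k) (g \<sigma>)) \<in> borel_measurable M"
  using assms by (induction k) simp_all

text \<open>The constants \<open>q k\<close> dominate the terms almost everywhere and are integrable
  for a finite measure, so the integrals of the norms are summable and sum and integral may be
  exchanged.\<close>

lemma (in finite_measure) has_bochner_integral_series:
  fixes g :: "nat \<Rightarrow> 'a \<Rightarrow> 'v::{banach, second_countable_topology}"
  assumes g: "\<And>k. g k \<in> borel_measurable M" and q: "\<And>k. AE x in M. norm (g k x) \<le> q k"
    and sm: "summable q"
  shows "has_bochner_integral M (\<lambda>x. \<Sum>k. g k x) (\<Sum>k. \<integral>x. g k x \<partial>M)"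
    "summable (\<lambda>k. \<integral>x. g k x \<partial>M)"
proof -
  have int: "integrable M (g k)" for k
    using g q by (intro integrable_const_bound)
  have "AE x in M. \<forall>k. norm (g k x) \<le> q k" using q by (simp add: AE_all_countable)
  then have ae: "AE x in M. summable (\<lambda>k. norm (g k x))"
    by eventually_elim (rule summable_comparison_test'[OF sm, of 0], simp)
  have le: "(\<integral>x. norm (g k x) \<partial>M) \<le> q k * measure M (space M)" for k
  proof -
    have "(\<integral>x. norm (g k x) \<partial>M) \<le> (\<integral>x. q k \<partial>M)"
      using int q by (intro integral_mono_AE) auto
    then show ?thesis by (simp add: mult.commute)
  qed
  have sn: "summable (\<lambda>k. \<integral>x. norm (g k x) \<partial>M)"
    by (rule summable_comparison_test'[OF summable_mult2[OF sm, of "measure M (space M)"], of 0])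
      (use le in simp)
  show "has_bochner_integral M (\<lambda>x. \<Sum>k. g k x) (\<Sum>k. \<integral>x. g k x \<partial>M)"
    using integrable_suminf[OF int ae sn] integral_suminf[OF int ae sn]
    by (simp add: has_bochner_integral_iff)
  show "summable (\<lambda>k. \<integral>x. g k x \<partial>M)"
    by (rule summable_norm_cancel, rule summable_comparison_test'[OF sn, of 0]) simp
qed

text \<open>The series is exp(tA) v: shifting its coefficients means applying \<open>A\<close>, so
  its derivative is \<open>A\<close> times itself.\<close>

lemma free_solution:
  fixes A :: "real ^ 'n ^ 'n" and v :: "real ^ 'n"
  defines "y \<equiv> exp_series (\<lambda>k. ((*v) A ^^ k) v)"
  assumes "0 \<le> t"
  shows "(\<lambda>s. A *v y s) absolutely_integrable_on {0..t}"
    "y t = v + integral {0..t} (\<lambda>s. A *v y s)"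
proof -
  obtain \<kappa> where \<kappa>: "0 < \<kappa>" "\<And>(A :: real ^ 'n ^ 'n) x. norm (A *v x) \<le> \<kappa> * norm A * norm x"
    using matrix_vector_bound by blast
  have b: "norm (((*v) A ^^ k) v) \<le> norm v * (\<kappa> * norm A) ^ k" for k
    using \<kappa> by (intro matrix_iterate_bound) auto
  have d: "(y has_vector_derivative A *v y s) (at s)" for s
    using has_vector_derivative_exp_series[OF b, of s]
    by (simp add: y_def bounded_linear_exp_series[OF matrix_vector_mul_bounded_linear b])
  have "continuous_on {0..t} y"
    using d by (intro continuous_at_imp_continuous_on ballI has_vector_derivative_continuous)
  then have "continuous_on {0..t} (\<lambda>s. A *v y s)"
    by (intro bounded_linear.continuous_on[OF matrix_vector_mul_bounded_linear])
  then show "(\<lambda>s. A *v y s) absolutely_integrable_on {0..t}"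
    by (rule absolutely_integrable_continuous_real)
  have "((\<lambda>s. A *v y s) has_integral y t - y 0) {0..t}"
    using d assms by (intro fundamental_theorem_of_calculus) (auto intro: has_vector_derivative_at_within)
  then show "y t = v + integral {0..t} (\<lambda>s. A *v y s)"
    by (simp add: integral_unique y_def exp_series_0)
qed

text \<open>The state at time \<open>T\<close> under the hinge input \<open>max 0 (s - \<tau>)\<close> is a power series in
  \<open>T - \<tau>\<close>, so that varying \<open>\<tau>\<close> isolates its coefficients, which average to the moments.\<close>

definition hinge_coeff :: "real ^ 'n ^ 'n \<Rightarrow> real ^ 'n \<Rightarrow> nat \<Rightarrow> real ^ 'n" where
  "hinge_coeff A v k = (if k < 2 then 0 else ((*v) A ^^ (k - 2)) v)"

text \<open>With two leading zeros the series solves y' = A y + s v from rest, since the input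
  enters the recursion of the coefficients at k = 1 only. Delayed by \<tau> it vanishes up to
  \<tau>; the fundamental theorem of calculus is applied with \<tau> as an exceptional point, which
  avoids a derivative at the kink of the delay.\<close>

lemma hinge_solution:
  fixes A :: "real ^ 'n ^ 'n" and v :: "real ^ 'n" and \<tau> :: real
  assumes t: "0 \<le> t" and \<tau>: "0 \<le> \<tau>" and y_def: "y = (\<lambda>t. exp_series (hinge_coeff A v) (max 0 (t - \<tau>)))"
  shows "(\<lambda>s. A *v y s + max 0 (s - \<tau>) *\<^sub>R v) absolutely_integrable_on {0..t}"
    "y t = integral {0..t} (\<lambda>s. A *v y s + max 0 (s - \<tau>) *\<^sub>R v)"
proof -
  obtain \<kappa> where \<kappa>: "0 < \<kappa>" "\<And>(A :: real ^ 'n ^ 'n) x. norm (A *v x) \<le> \<kappa> * norm A * norm x"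
    using matrix_vector_bound by blast
  \<comment> \<open>At least 1, so that \<open>C ^ (k - 2) \<le> C ^ k\<close>.\<close>
  define C where "C = max 1 (\<kappa> * norm A)"
  have C: "norm (A *v x) \<le> C * norm x" for x
  proof -
    have "\<kappa> * norm A * norm x \<le> C * norm x" by (intro mult_right_mono) (auto simp: C_def)
    with \<kappa>(2)[of A x] show ?thesis by (rule order_trans)
  qed
  have b: "norm (hinge_coeff A v k) \<le> norm v * C ^ k" for k
  proof (cases "k < 2")
    case False
    have "norm (((*v) A ^^ (k - 2)) v) \<le> norm v * C ^ (k - 2)"
      using C by (intro matrix_iterate_bound) (auto simp: C_def)
    also have "\<dots> \<le> norm v * C ^ k"
      by (intro mult_left_mono power_increasing) (auto simp: C_def)
    finally show ?thesis using False by (simp add: hinge_coeff_def)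
  qed (auto simp: hinge_coeff_def C_def)
  let ?e = "exp_series (hinge_coeff A v)"
  have shift: "hinge_coeff A v (Suc k) = A *v hinge_coeff A v k + (if k = 1 then v else 0)" for k
  proof -
    consider "k = 0" | "k = 1" | j where "k = Suc (Suc j)" by (metis One_nat_def not0_implies_Suc)
    then show ?thesis by cases (simp_all add: hinge_coeff_def)
  qed
  have e_shift: "exp_series (\<lambda>k. hinge_coeff A v (Suc k)) s = A *v ?e s + s *\<^sub>R v" for s
  proof -
    have "(\<lambda>k. (s ^ k / fact k) *\<^sub>R (A *v hinge_coeff A v k)) sums (A *v ?e s)"
      using bounded_linear.sums[OF matrix_vector_mul_bounded_linear[of A]
          summable_sums[OF summable_exp_series[OF b, of s]]]
      by (simp add: exp_series_def matrix_vector_mult_scaleR)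
    moreover have "(\<lambda>k. if k = 1 then (s ^ k / fact k) *\<^sub>R v else 0) sums ((s ^ 1 / fact 1) *\<^sub>R v)"
      using sums_single[of 1 "\<lambda>k. (s ^ k / fact k) *\<^sub>R v"] .
    ultimately have "(\<lambda>k. (s ^ k / fact k) *\<^sub>R (A *v hinge_coeff A v k)
        + (if k = 1 then (s ^ k / fact k) *\<^sub>R v else 0)) sums (A *v ?e s + (s ^ 1 / fact 1) *\<^sub>R v)"
      by (rule sums_add)
    also have "(\<lambda>k. (s ^ k / fact k) *\<^sub>R (A *v hinge_coeff A v k)
        + (if k = 1 then (s ^ k / fact k) *\<^sub>R v else 0))
        = (\<lambda>k. (s ^ k / fact k) *\<^sub>R hinge_coeff A v (Suc k))"
      by (auto simp: shift scaleR_add_right fun_eq_iff)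
    finally show ?thesis by (simp add: exp_series_def sums_iff)
  qed
  have d: "(?e has_vector_derivative A *v ?e s + s *\<^sub>R v) (at s)" for s
    using has_vector_derivative_exp_series[OF b, of s] by (simp add: e_shift)
  have e0: "?e 0 = 0" by (simp add: exp_series_0 hinge_coeff_def)
  have ce: "continuous_on UNIV ?e"
    using d by (intro continuous_at_imp_continuous_on ballI has_vector_derivative_continuous)
  have cy: "continuous_on S y" for S
    unfolding y_def by (rule continuous_on_compose2[OF ce]) (auto intro!: continuous_intros)
  have cr: "continuous_on {0..t} (\<lambda>s. A *v y s + max 0 (s - \<tau>) *\<^sub>R v)"
    by (intro continuous_intros bounded_linear.continuous_on[OF matrix_vector_mul_bounded_linear] cy)
  then show "(\<lambda>s. A *v y s + max 0 (s - \<tau>) *\<^sub>R v) absolutely_integrable_on {0..t}"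
    by (rule absolutely_integrable_continuous_real)
  have "((\<lambda>s. A *v y s + max 0 (s - \<tau>) *\<^sub>R v) has_integral y t - y 0) {0..t}"
  proof (rule fundamental_theorem_of_calculus_interior_strong[of "{\<tau>}"])
    fix s assume s: "s \<in> {0<..<t} - {\<tau>}"
    show "(y has_vector_derivative A *v y s + max 0 (s - \<tau>) *\<^sub>R v) (at s)"
    proof (cases "s < \<tau>")
      case True
      then have "A *v y s + max 0 (s - \<tau>) *\<^sub>R v = 0" by (simp add: y_def e0)
      moreover have "(y has_vector_derivative 0) (at s)"
        by (rule has_vector_derivative_transform_within_open[OF has_vector_derivative_const[of 0], of "{..<\<tau>}"])
          (use True e0 in \<open>auto simp: y_def max_def\<close>)
      ultimately show ?thesis by (simp only:)
    next
      case False
      with s have s\<tau>: "\<tau> < s" by auto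
      have "((?e \<circ> (\<lambda>s. s - \<tau>)) has_vector_derivative 1 *\<^sub>R (A *v ?e (s - \<tau>) + (s - \<tau>) *\<^sub>R v)) (at s)"
        by (intro vector_diff_chain_at d) (auto intro!: derivative_eq_intros)
      then have "((\<lambda>s. ?e (s - \<tau>)) has_vector_derivative A *v y s + max 0 (s - \<tau>) *\<^sub>R v) (at s)"
        using s\<tau> by (simp add: o_def y_def)
      then show ?thesis
        by (rule has_vector_derivative_transform_within_open[of _ _ _ "{\<tau><..}"])
          (use s\<tau> in \<open>auto simp: y_def max_def\<close>)
    qed
  qed (use t cy in simp_all)
  then have "integral {0..t} (\<lambda>s. A *v y s + max 0 (s - \<tau>) *\<^sub>R v) = y t - y 0"
    by (rule integral_unique)
  moreover have "y 0 = 0" using \<tau> e0 unfolding y_def by simp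
  ultimately show "y t = integral {0..t} (\<lambda>s. A *v y s + max 0 (s - \<tau>) *\<^sub>R v)"
    by (metis diff_zero)
qed

section \<open>Averaged controllability and moments\<close>

text \<open>If m is the first index with a nonzero coefficient, division by \<open>r ^ m\<close>
  leaves a series that tends to \<open>a m\<close> as r decreases to 0 and yet vanishes for small
  positive r.\<close>

lemma power_series_eq_zero_imp:
  fixes a :: "nat \<Rightarrow> real"
  assumes sm: "\<And>r. summable (\<lambda>k. a k * r ^ k)" and T: "0 < T"
    and z: "\<And>r. 0 < r \<Longrightarrow> r \<le> T \<Longrightarrow> (\<Sum>k. a k * r ^ k) = 0"
  shows "a k = 0"
proof (rule ccontr)
  assume "a k \<noteq> 0"
  define m where "m = (LEAST k. a k \<noteq> 0)"
  have m: "a m \<noteq> 0" unfolding m_def using \<open>a k \<noteq> 0\<close> by (rule LeastI)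
  have below: "a j = 0" if "j < m" for j using not_less_Least that unfolding m_def by blast
  define f where "f r = (\<Sum>j. a (j + m) * r ^ j)" for r
  have smf: "summable (\<lambda>j. a (j + m) * r ^ j)" for r
  proof (cases "r = 0")
    case False
    have "summable (\<lambda>j. (a (j + m) * r ^ (j + m)) * (1 / r ^ m))"
      using summable_ignore_initial_segment[OF sm[of r], of m] by (rule summable_mult2)
    then show ?thesis using False by (simp add: power_add field_simps)
  qed simp
  have "(f \<longlongrightarrow> a (0 + m)) (at 0)"
    by (rule powser_limit_0[of 1]) (use smf in \<open>auto simp: f_def intro!: summable_sums\<close>)
  then have lim: "(f \<longlongrightarrow> a m) (at_right 0)"
    by (simp add: filterlim_at_split)
  have "f r = 0" if r: "0 < r" "r < T" for r
  proof -
    have "(\<Sum>k. a k * r ^ k) = (\<Sum>j. a (j + m) * r ^ (j + m)) + (\<Sum>j<m. a j * r ^ j)"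
      by (rule suminf_split_initial_segment[OF sm])
    also have "(\<Sum>j<m. a j * r ^ j) = 0" by (intro sum.neutral) (simp add: below)
    also have "(\<Sum>j. a (j + m) * r ^ (j + m)) = (\<Sum>j. a (j + m) * r ^ j * r ^ m)"
      by (simp add: power_add mult_ac)
    also have "\<dots> = f r * r ^ m" unfolding f_def by (rule suminf_mult2[OF smf, symmetric])
    finally show ?thesis using z[of r] r by simp
  qed
  then have "eventually (\<lambda>r. f r = 0) (at_right 0)"
    using T unfolding eventually_at_right_field by blast
  then have "(f \<longlongrightarrow> 0) (at_right 0)" by (rule tendsto_eventually)
  from tendsto_unique[OF _ lim this] m show False by simp
qed

definition moment ::
  "'a measure \<Rightarrow> ('a \<Rightarrow> real ^ 'n ^ 'n) \<Rightarrow> ('a \<Rightarrow> real ^ 'm ^ 'n) \<Rightarrow> nat \<Rightarrow> 'm \<Rightarrow> real ^ 'n" where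
  "moment \<mu> A B k i = (\<integral>\<sigma>. ((*v) (A \<sigma>) ^^ k) (B \<sigma> *v axis i 1) \<partial>\<mu>)"

lemma Linfty_matrix_bound:
  fixes A :: "'a \<Rightarrow> real ^ 'n ^ 'm"
  assumes "A \<in> Linfty \<mu>"
  obtains C where "0 \<le> C" "AE \<sigma> in \<mu>. \<forall>x. norm (A \<sigma> *v x) \<le> C * norm x"
proof -
  obtain \<kappa> where \<kappa>: "0 < \<kappa>" "\<And>(A :: real ^ 'n ^ 'm) x. norm (A *v x) \<le> \<kappa> * norm A * norm x"
    using matrix_vector_bound by blast
  from assms obtain D where D: "AE \<sigma> in \<mu>. norm (A \<sigma>) \<le> D" by (auto simp: Linfty_def)
  have "AE \<sigma> in \<mu>. \<forall>x. norm (A \<sigma> *v x) \<le> (\<kappa> * max 0 D) * norm x"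
    using D
  proof eventually_elim
    case (elim \<sigma>)
    have "\<kappa> * norm (A \<sigma>) * norm x \<le> \<kappa> * max 0 D * norm x" for x :: "real ^ 'n"
      using \<kappa>(1) elim by (intro mult_right_mono mult_left_mono) auto
    with \<kappa>(2) show ?case by (meson order_trans)
  qed
  then show thesis using \<kappa>(1) by (intro that[of "\<kappa> * max 0 D"]) auto
qed

lemma ensemble_solution_add:
  assumes "ensemble_solution A B u x0 x" "ensemble_solution A B u' x0' x'"
  shows "ensemble_solution A B (\<lambda>s. u s + u' s) (\<lambda>\<sigma>. x0 \<sigma> + x0' \<sigma>) (\<lambda>t \<sigma>. x t \<sigma> + x' t \<sigma>)"
  unfolding ensemble_solution_def
proof (intro allI impI)
  fix \<sigma> and t :: real assume t: "0 \<le> t"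
  let ?f = "\<lambda>s. A \<sigma> *v x s \<sigma> + B \<sigma> *v u s" and ?f' = "\<lambda>s. A \<sigma> *v x' s \<sigma> + B \<sigma> *v u' s"
  have f: "?f absolutely_integrable_on {0..t}" "x t \<sigma> = x0 \<sigma> + integral {0..t} ?f"
    and f': "?f' absolutely_integrable_on {0..t}" "x' t \<sigma> = x0' \<sigma> + integral {0..t} ?f'"
    using assms t unfolding ensemble_solution_def by blast+
  have eq: "(\<lambda>s. A \<sigma> *v (x s \<sigma> + x' s \<sigma>) + B \<sigma> *v (u s + u' s)) = (\<lambda>s. ?f s + ?f' s)"
    by (simp add: vec.add algebra_simps)
  show "(\<lambda>s. A \<sigma> *v (x s \<sigma> + x' s \<sigma>) + B \<sigma> *v (u s + u' s)) absolutely_integrable_on {0..t} \<and>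
      x t \<sigma> + x' t \<sigma> = x0 \<sigma> + x0' \<sigma> +
        integral {0..t} (\<lambda>s. A \<sigma> *v (x s \<sigma> + x' s \<sigma>) + B \<sigma> *v (u s + u' s))"
    unfolding eq using f f' integral_add[of ?f "{0..t}" ?f'] set_integral_add(1)[OF f(1) f'(1)]
    by (simp add: set_lebesgue_integral_eq_integral(1))
qed

lemma ensemble_solution_scaleR:
  assumes "ensemble_solution A B u x0 x"
  shows "ensemble_solution A B (\<lambda>s. c *\<^sub>R u s) (\<lambda>\<sigma>. c *\<^sub>R x0 \<sigma>) (\<lambda>t \<sigma>. c *\<^sub>R x t \<sigma>)"
  unfolding ensemble_solution_def
proof (intro allI impI)
  fix \<sigma> and t :: real assume t: "0 \<le> t"
  let ?f = "\<lambda>s. A \<sigma> *v x s \<sigma> + B \<sigma> *v u s"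
  have f: "?f absolutely_integrable_on {0..t}" "x t \<sigma> = x0 \<sigma> + integral {0..t} ?f"
    using assms t unfolding ensemble_solution_def by blast+
  have eq: "(\<lambda>s. A \<sigma> *v (c *\<^sub>R x s \<sigma>) + B \<sigma> *v (c *\<^sub>R u s)) = (\<lambda>s. c *\<^sub>R ?f s)"
    by (simp add: matrix_vector_mult_scaleR scaleR_add_right)
  show "(\<lambda>s. A \<sigma> *v (c *\<^sub>R x s \<sigma>) + B \<sigma> *v (c *\<^sub>R u s)) absolutely_integrable_on {0..t} \<and>
      c *\<^sub>R x t \<sigma> = c *\<^sub>R x0 \<sigma> + integral {0..t} (\<lambda>s. A \<sigma> *v (c *\<^sub>R x s \<sigma>) + B \<sigma> *v (c *\<^sub>R u s))"
    unfolding eq f(2) integral_cmul scaleR_add_right[symmetric]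
    using absolutely_integrable_scaleR_left[OF f(1), of c] by simp
qed

context prob_space
begin

context
  fixes A :: "'a \<Rightarrow> real ^ 'n ^ 'n" and B :: "'a \<Rightarrow> real ^ 'm ^ 'n"
  assumes A: "A \<in> Linfty M" and B: "B \<in> Linfty M"
begin

lemma measurable_ensemble [measurable]: "A \<in> borel_measurable M" "B \<in> borel_measurable M"
  using A B by (auto simp: Linfty_def)

text \<open>The quantifiers over \<open>v\<close> and \<open>k\<close> stand inside
  \<open>AE\<close>: one null set serves all vectors, including those that depend on
  \<sigma>.\<close>

lemma iterate_AE_bound:
  obtains C where "1 \<le> C" "AE \<sigma> in M. \<forall>v k. norm (((*v) (A \<sigma>) ^^ k) v) \<le> norm v * C ^ k"
proof -
  obtain C where C: "0 \<le> C" "AE \<sigma> in M. \<forall>x. norm (A \<sigma> *v x) \<le> C * norm x"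
    using Linfty_matrix_bound[OF A] by blast
  have "AE \<sigma> in M. \<forall>v k. norm (((*v) (A \<sigma>) ^^ k) v) \<le> norm v * max 1 C ^ k"
    using C(2)
  proof eventually_elim
    case (elim \<sigma>)
    have "C * norm x \<le> max 1 C * norm x" for x :: "real ^ 'n" by (intro mult_right_mono) auto
    with elim have "norm (A \<sigma> *v x) \<le> max 1 C * norm x" for x by (meson order_trans)
    then show ?case by (intro allI matrix_iterate_bound) auto
  qed
  then show thesis by (intro that[of "max 1 C"]) auto
qed

lemma free_average:
  assumes "x0 \<in> Linfty M"
  shows "\<exists>m. has_bochner_integral M (\<lambda>\<sigma>. exp_series (\<lambda>k. ((*v) (A \<sigma>) ^^ k) (x0 \<sigma>)) t) m"
proof -
  obtain C where C: "1 \<le> C" "AE \<sigma> in M. \<forall>v k. norm (((*v) (A \<sigma>) ^^ k) v) \<le> norm v * C ^ k"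
    using iterate_AE_bound by blast
  from assms obtain D where D: "AE \<sigma> in M. norm (x0 \<sigma>) \<le> D" and [measurable]: "x0 \<in> borel_measurable M"
    by (auto simp: Linfty_def)
  have "AE \<sigma> in M. norm ((t ^ k / fact k) *\<^sub>R ((*v) (A \<sigma>) ^^ k) (x0 \<sigma>)) \<le> D * ((\<bar>t\<bar> * C) ^ k / fact k)" for k
    using C(2) D
  proof eventually_elim
    case (elim \<sigma>)
    have "norm (((*v) (A \<sigma>) ^^ k) (x0 \<sigma>)) \<le> norm (x0 \<sigma>) * C ^ k" using elim by blast
    also have "\<dots> \<le> D * C ^ k" using elim C(1) by (intro mult_right_mono) auto
    finally show ?case by (rule exp_series_term_bound)
  qed
  note bound = this
  have "(\<lambda>\<sigma>. (t ^ k / fact k) *\<^sub>R ((*v) (A \<sigma>) ^^ k) (x0 \<sigma>)) \<in> borel_measurable M" for k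
    by measurable
  from has_bochner_integral_series(1)[OF this bound summable_exp_bound]
  show ?thesis unfolding exp_series_def by blast
qed

lemma hinge_average:
  "has_bochner_integral M (\<lambda>\<sigma>. exp_series (hinge_coeff (A \<sigma>) (B \<sigma> *v axis i 1)) t)
     (\<Sum>k. (t ^ k / fact k) *\<^sub>R (if k < 2 then 0 else moment M A B (k - 2) i))" (is ?thesis1)
  "summable (\<lambda>k. (t ^ k / fact k) *\<^sub>R (if k < 2 then 0 else moment M A B (k - 2) i))" (is ?thesis2)
proof -
  obtain C where C: "1 \<le> C" "AE \<sigma> in M. \<forall>v k. norm (((*v) (A \<sigma>) ^^ k) v) \<le> norm v * C ^ k"
    using iterate_AE_bound by blast
  obtain D where D: "0 \<le> D" "AE \<sigma> in M. \<forall>x. norm (B \<sigma> *v x) \<le> D * norm x"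
    using Linfty_matrix_bound[OF B] by blast
  let ?g = "\<lambda>k \<sigma>. (t ^ k / fact k) *\<^sub>R hinge_coeff (A \<sigma>) (B \<sigma> *v axis i 1) k"
  have ae: "AE \<sigma> in M. norm (?g k \<sigma>) \<le> D * ((\<bar>t\<bar> * C) ^ k / fact k)" for k
    using C(2) D(2)
  proof eventually_elim
    case (elim \<sigma>)
    have "norm (hinge_coeff (A \<sigma>) (B \<sigma> *v axis i 1) k) \<le> D * C ^ k"
    proof (cases "k < 2")
      case False
      have "norm (((*v) (A \<sigma>) ^^ (k - 2)) (B \<sigma> *v axis i 1)) \<le> norm (B \<sigma> *v axis i 1) * C ^ (k - 2)"
        using elim by blast
      also have "\<dots> \<le> (D * norm (axis i 1 :: real ^ 'm)) * C ^ (k - 2)"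
        using elim(2) C(1) by (intro mult_right_mono spec[OF elim(2)]) auto
      also have "\<dots> \<le> D * C ^ k"
        using C(1) D(1) by (simp add: norm_axis_1) (intro mult_left_mono power_increasing, auto)
      finally show ?thesis using False by (simp add: hinge_coeff_def)
    qed (use C(1) D(1) in \<open>simp add: hinge_coeff_def\<close>)
    then show ?case by (rule exp_series_term_bound)
  qed
  have meas: "?g k \<in> borel_measurable M" for k
    unfolding hinge_coeff_def by (cases "k < 2") simp_all
  have int: "(\<integral>\<sigma>. ?g k \<sigma> \<partial>M) = (t ^ k / fact k) *\<^sub>R (if k < 2 then 0 else moment M A B (k - 2) i)" for k
    by (simp add: hinge_coeff_def moment_def)
  show ?thesis1 ?thesis2
    using has_bochner_integral_series[OF meas ae summable_exp_bound]
    unfolding int exp_series_def by auto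
qed

section \<open>Averages reachable from rest\<close>

definition reachable_averages :: "real \<Rightarrow> (real ^ 'n) set" where
  "reachable_averages T = {v. \<exists>u x. admissible_control u \<and>
     ensemble_solution A B u (\<lambda>_. 0) x \<and> has_bochner_integral M (x T) v}"

lemma subspace_reachable_averages: "subspace (reachable_averages T)"
proof (rule subspaceI)
  have "ensemble_solution A B (\<lambda>_. 0) (\<lambda>_. 0) (\<lambda>_ _. 0)"
    by (simp add: ensemble_solution_def)
  then show "0 \<in> reachable_averages T"
    unfolding reachable_averages_def
    by (auto simp: admissible_control_def intro!: exI[of _ "\<lambda>_. 0"] exI[of _ "\<lambda>_ _. 0"])
next
  fix v w assume "v \<in> reachable_averages T" "w \<in> reachable_averages T"
  then obtain u x u' x' where *: "admissible_control u" "ensemble_solution A B u (\<lambda>_. 0) x"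
      "has_bochner_integral M (x T) v" "admissible_control u'" "ensemble_solution A B u' (\<lambda>_. 0) x'"
      "has_bochner_integral M (x' T) w"
    unfolding reachable_averages_def by blast
  have "admissible_control (\<lambda>s. u s + u' s)"
    using *(1,4) by (auto simp: admissible_control_def intro!: set_integral_add(1))
  moreover have "has_bochner_integral M (\<lambda>\<sigma>. x T \<sigma> + x' T \<sigma>) (v + w)"
    using *(3,6) by (rule has_bochner_integral_add)
  ultimately show "v + w \<in> reachable_averages T"
    using ensemble_solution_add[OF *(2,5)] unfolding reachable_averages_def by auto
next
  fix c v assume "v \<in> reachable_averages T"
  then obtain u x where *: "admissible_control u" "ensemble_solution A B u (\<lambda>_. 0) x"
      "has_bochner_integral M (x T) v"
    unfolding reachable_averages_def by blast
  have "admissible_control (\<lambda>s. c *\<^sub>R u s)"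
    using *(1) by (auto simp: admissible_control_def)
  moreover have "has_bochner_integral M (\<lambda>\<sigma>. c *\<^sub>R x T \<sigma>) (c *\<^sub>R v)"
    using *(3) by (rule has_bochner_integral_scaleR_right)
  ultimately show "c *\<^sub>R v \<in> reachable_averages T"
    using ensemble_solution_scaleR[OF *(2), of c] unfolding reachable_averages_def by auto
qed

text \<open>A ramp switched on at time \<open>T - r\<close> runs for time r, so the average at
  \<open>T\<close> is the series evaluated at r.\<close>

lemma hinge_reachable:
  assumes "0 < r" "r \<le> T"
  shows "(\<Sum>k. (r ^ k / fact k) *\<^sub>R (if k < 2 then 0 else moment M A B (k - 2) i)) \<in> reachable_averages T"
proof -
  let ?u = "\<lambda>s. max 0 (s - (T - r)) *\<^sub>R (axis i 1 :: real ^ 'm)"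
  let ?x = "\<lambda>t \<sigma>. exp_series (hinge_coeff (A \<sigma>) (B \<sigma> *v axis i 1)) (max 0 (t - (T - r)))"
  have "admissible_control ?u"
    unfolding admissible_control_def
    by (auto intro!: absolutely_integrable_continuous_real continuous_intros)
  moreover have "ensemble_solution A B ?u (\<lambda>_. 0) ?x"
    unfolding ensemble_solution_def
  proof (intro allI impI)
    fix \<sigma> and t :: real assume "0 \<le> t"
    from hinge_solution[OF this _ refl, of "T - r" "A \<sigma>" "B \<sigma> *v axis i 1"] assms
    show "(\<lambda>s. A \<sigma> *v ?x s \<sigma> + B \<sigma> *v ?u s) absolutely_integrable_on {0..t} \<and>
        ?x t \<sigma> = 0 + integral {0..t} (\<lambda>s. A \<sigma> *v ?x s \<sigma> + B \<sigma> *v ?u s)"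
      unfolding matrix_vector_mult_scaleR by simp
  qed
  moreover have "has_bochner_integral M (?x T)
      (\<Sum>k. (r ^ k / fact k) *\<^sub>R (if k < 2 then 0 else moment M A B (k - 2) i))"
    using hinge_average(1)[of i r] assms by simp
  ultimately show ?thesis unfolding reachable_averages_def by blast
qed

text \<open>A proper subspace has a nonzero normal vector w. Paired with the averages of all delayed
  ramps it gives a power series in r that vanishes on (0, T]; its coefficients are, up to
  factorials, the products of w with the moments.\<close>

lemma reachable_averages_UNIV:
  assumes T: "0 < T" and full: "\<And>w. (\<And>k i. w \<bullet> moment M A B k i = 0) \<Longrightarrow> w = 0"
  shows "reachable_averages T = UNIV"
proof (rule ccontr)
  assume "reachable_averages T \<noteq> UNIV"
  then have "dim (reachable_averages T) < DIM(real ^ 'n)"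
    using subspace_reachable_averages dim_eq_full dim_subset_UNIV
    by (metis le_neq_implies_less span_eq_iff)
  then obtain w where w: "w \<noteq> 0" "\<And>v. v \<in> reachable_averages T \<Longrightarrow> orthogonal w v"
    using orthogonal_to_subspace_exists by (metis span_base)
  have "w \<bullet> moment M A B k i = 0" for k i
  proof -
    define a where "a k = (if k < 2 then 0 else w \<bullet> moment M A B (k - 2) i) / fact k" for k
    have conv: "w \<bullet> ((r ^ k / fact k) *\<^sub>R (if k < 2 then 0 else moment M A B (k - 2) i)) = a k * r ^ k" for k r
      by (simp add: a_def)
    have sm: "summable (\<lambda>k. a k * r ^ k)" for r
      using bounded_linear.summable[OF bounded_linear_inner_right[of w] hinge_average(2)[of r i]]
      unfolding conv .
    have "(\<Sum>k. a k * r ^ k) = 0" if "0 < r" "r \<le> T" for r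
      using w(2)[OF hinge_reachable[OF that, of i]]
        bounded_linear.suminf[OF bounded_linear_inner_right[of w] hinge_average(2)[of r i]]
      unfolding conv by (simp add: orthogonal_def)
    \<comment> \<open>Index k + 2 skips the two leading zeros of the hinge coefficients.\<close>
    from power_series_eq_zero_imp[OF sm T this, of "k + 2"] show ?thesis by (simp add: a_def)
  qed
  with full w(1) show False by blast
qed

text \<open>By superposition it suffices to steer from rest to the target minus the average of the
  free evolution.\<close>

lemma averaged_controllableI:
  assumes full: "\<And>w. (\<And>k i. w \<bullet> moment M A B k i = 0) \<Longrightarrow> w = 0"
  shows "averaged_controllable M A B"
  unfolding averaged_controllable_def
proof (intro ballI allI impI)
  fix x0 :: "'a \<Rightarrow> real ^ 'n" and xstar and T :: real
  assume x0: "x0 \<in> Linfty M" and T: "0 < T"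
  let ?f = "\<lambda>t \<sigma>. exp_series (\<lambda>k. ((*v) (A \<sigma>) ^^ k) (x0 \<sigma>)) t"
  obtain m where m: "has_bochner_integral M (?f T) m" using free_average[OF x0] by blast
  have f: "ensemble_solution A B (\<lambda>_. 0) x0 ?f"
    unfolding ensemble_solution_def
  proof (intro allI impI)
    fix \<sigma> and t :: real assume "0 \<le> t"
    from free_solution[OF this, of "A \<sigma>" "x0 \<sigma>"]
    show "(\<lambda>s. A \<sigma> *v ?f s \<sigma> + B \<sigma> *v 0) absolutely_integrable_on {0..t} \<and>
        ?f t \<sigma> = x0 \<sigma> + integral {0..t} (\<lambda>s. A \<sigma> *v ?f s \<sigma> + B \<sigma> *v 0)"
      by simp
  qed
  have "xstar - m \<in> reachable_averages T" using reachable_averages_UNIV[OF T full] by simp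
  then obtain u x where *: "admissible_control u" "ensemble_solution A B u (\<lambda>_. 0) x"
      "has_bochner_integral M (x T) (xstar - m)"
    unfolding reachable_averages_def by blast
  have "has_bochner_integral M (\<lambda>\<sigma>. ?f T \<sigma> + x T \<sigma>) (m + (xstar - m))"
    using m *(3) by (rule has_bochner_integral_add)
  then show "\<exists>u x. admissible_control u \<and> ensemble_solution A B u x0 x \<and> has_bochner_integral M (x T) xstar"
    using *(1) ensemble_solution_add[OF f *(2)]
    by (intro exI[of _ u] exI[of _ "\<lambda>t \<sigma>. ?f t \<sigma> + x t \<sigma>"]) auto
qed

end

end

section \<open>Expansion of solutions in iterated integrals\<close>

definition iterated_integral :: "nat \<Rightarrow> (real \<Rightarrow> 'v::euclidean_space) \<Rightarrow> real \<Rightarrow> 'v" where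
  "iterated_integral k f = ((\<lambda>g t. integral {0..t} g) ^^ k) f"

lemma iterated_integral_0 [simp]: "iterated_integral 0 f = f"
  by (simp add: iterated_integral_def)

lemma iterated_integral_Suc: "iterated_integral (Suc k) f t = integral {0..t} (iterated_integral k f)"
  by (simp add: iterated_integral_def)

lemma iterated_integral_Suc':
  "iterated_integral (Suc k) f = iterated_integral k (\<lambda>t. integral {0..t} f)"
  by (simp only: iterated_integral_def funpow_Suc_right o_def)

text \<open>Meant for the solution and for the primitive of the control, which are continuous even
  though the control is merely integrable. The factorial arises by integrating the bound of the
  previous order.\<close>

lemma iterated_integral_bound:
  assumes f: "continuous_on {0..T} f" and K: "\<And>t. t \<in> {0..T} \<Longrightarrow> norm (f t) \<le> K"
  shows "continuous_on {0..T} (iterated_integral k f)"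
    "t \<in> {0..T} \<Longrightarrow> norm (iterated_integral k f t) \<le> K * (t ^ k / fact k)"
proof (induction k arbitrary: t)
  case 0
  { case 1 show ?case using f by simp next case 2 then show ?case using K by simp }
next
  case (Suc k)
  have int: "iterated_integral k f integrable_on {0..t}" if "t \<le> T" for t
    using Suc.IH(1) that by (intro integrable_continuous_real) (auto intro: continuous_on_subset)
  {
    case 1
    show ?case unfolding iterated_integral_Suc[abs_def]
      using int[of T] by (intro indefinite_integral_continuous_1) auto
  next
    case 2
    have "((\<lambda>s. K * (s ^ k / fact k)) has_integral
        K * (t ^ Suc k / fact (Suc k)) - K * (0 ^ Suc k / fact (Suc k))) {0..t}"
    proof (rule fundamental_theorem_of_calculus)
      fix s :: real
      have "((\<lambda>s. K * (s ^ Suc k / fact (Suc k))) has_real_derivative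
          K * (real (Suc k) * s ^ (Suc k - Suc 0) / fact (Suc k))) (at s within {0..t})"
        by (intro DERIV_cmult DERIV_cdivide DERIV_pow)
      also have "K * (real (Suc k) * s ^ (Suc k - Suc 0) / fact (Suc k)) = K * (s ^ k / fact k)"
        by (simp add: divide_simps)
      finally show "((\<lambda>s. K * (s ^ Suc k / fact (Suc k))) has_vector_derivative K * (s ^ k / fact k))
          (at s within {0..t})"
        by (simp only: has_real_derivative_iff_has_vector_derivative)
    qed (use 2 in simp)
    then have *: "((\<lambda>s. K * (s ^ k / fact k)) has_integral K * (t ^ Suc k / fact (Suc k))) {0..t}"
      by simp
    have "norm (integral {0..t} (iterated_integral k f)) \<le> integral {0..t} (\<lambda>s. K * (s ^ k / fact k))"
      using 2 int * Suc.IH(2) by (intro integral_norm_bound_integral) auto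
    also have "\<dots> = K * (t ^ Suc k / fact (Suc k))" using * by (rule integral_unique)
    finally show ?case by (simp only: iterated_integral_Suc)
  }
qed

text \<open>Iterating the integral equation expands its solution in iterated integrals of the input;
  no matrix exponential or uniqueness theorem is needed.\<close>

lemma solution_series:
  fixes A :: "real ^ 'n ^ 'n" and B :: "real ^ 'm ^ 'n" and u :: "real \<Rightarrow> real ^ 'm"
  assumes T: "0 \<le> T" and u: "u absolutely_integrable_on {0..T}"
    and sol: "\<And>t. 0 \<le> t \<Longrightarrow> (\<lambda>s. A *v x s + B *v u s) absolutely_integrable_on {0..t}"
      "\<And>t. 0 \<le> t \<Longrightarrow> x t = integral {0..t} (\<lambda>s. A *v x s + B *v u s)"
  shows "(\<lambda>k. ((*v) A ^^ k) (B *v iterated_integral (Suc k) u T)) sums x T"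
proof -
  let ?I = iterated_integral
  have int_u: "u integrable_on {0..t}" if "t \<le> T" for t
    by (rule integrable_on_subinterval[OF set_lebesgue_integral_eq_integral(1)[OF u]]) (use that in auto)
  have "continuous_on {0..T} (\<lambda>t. integral {0..t} (\<lambda>s. A *v x s + B *v u s))"
    using sol(1)[OF T] by (intro indefinite_integral_continuous_1 set_lebesgue_integral_eq_integral(1))
  then have cx: "continuous_on {0..T} x"
    by (rule continuous_on_eq) (use sol(2) in auto)
  have "compact (x ` {0..T})" using cx by (intro compact_continuous_image) auto
  then obtain K where K: "\<And>t. t \<in> {0..T} \<Longrightarrow> norm (x t) \<le> K"
    using compact_imp_bounded bounded_iff by (metis imageI)
  have cu: "continuous_on {0..T} (\<lambda>t. integral {0..t} u)"
    using int_u[of T] by (intro indefinite_integral_continuous_1) auto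
  have cIx: "continuous_on {0..T} (?I N x)" for N by (rule iterated_integral_bound(1)[OF cx K])
  \<comment> \<open>The control need not be bounded; its iterated integrals of positive order are
    those of its continuous primitive.\<close>
  have cIu: "?I N u integrable_on {0..t}" if "t \<le> T" for N t
  proof (cases N)
    case (Suc N')
    have "compact ((\<lambda>t. integral {0..t} u) ` {0..T})" using cu by (intro compact_continuous_image) auto
    then obtain K' where "\<And>t. t \<in> {0..T} \<Longrightarrow> norm (integral {0..t} u) \<le> K'"
      using compact_imp_bounded bounded_iff by (metis imageI)
    from iterated_integral_bound(1)[OF cu this, of N'] that show ?thesis
      unfolding Suc iterated_integral_Suc'
      by (intro integrable_continuous_real) (auto intro: continuous_on_subset)
  qed (use int_u that in simp)
  have cIx': "?I N x integrable_on {0..t}" if "t \<le> T" for N t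
    using that by (intro integrable_continuous_real continuous_on_subset[OF cIx]) auto
  have lin: "integral {0..t} (\<lambda>s. A *v ?I N x s + B *v ?I N u s) = A *v ?I (Suc N) x t + B *v ?I (Suc N) u t"
    if "t \<le> T" for t N
  proof -
    have "((\<lambda>s. A *v ?I N x s) has_integral A *v integral {0..t} (?I N x)) {0..t}"
      using has_integral_linear[OF integrable_integral[OF cIx'[OF that]] matrix_vector_mul_bounded_linear[of A]]
      by (simp add: o_def)
    moreover have "((\<lambda>s. B *v ?I N u s) has_integral B *v integral {0..t} (?I N u)) {0..t}"
      using has_integral_linear[OF integrable_integral[OF cIu[OF that]] matrix_vector_mul_bounded_linear[of B]]
      by (simp add: o_def)
    ultimately have "((\<lambda>s. A *v ?I N x s + B *v ?I N u s) has_integral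
        A *v integral {0..t} (?I N x) + B *v integral {0..t} (?I N u)) {0..t}"
      by (rule has_integral_add)
    then show ?thesis unfolding iterated_integral_Suc by (rule integral_unique)
  qed
  \<comment> \<open>The integral equation, integrated N times.\<close>
  have step: "?I N x t = A *v ?I (Suc N) x t + B *v ?I (Suc N) u t" if "t \<in> {0..T}" for N t
    using that
  proof (induction N arbitrary: t)
    case 0
    then show ?case using sol(2)[of t] lin[of t 0] by simp
  next
    case (Suc N)
    have "?I (Suc N) x t = integral {0..t} (?I N x)" by (rule iterated_integral_Suc)
    also have "\<dots> = integral {0..t} (\<lambda>s. A *v ?I (Suc N) x s + B *v ?I (Suc N) u s)"
      by (rule integral_cong, rule Suc.IH) (use Suc.prems in auto)
    finally show ?case using lin[of t "Suc N"] Suc.prems by simp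
  qed
  have expand: "x T = (\<Sum>k<N. ((*v) A ^^ k) (B *v ?I (Suc k) u T)) + ((*v) A ^^ N) (?I N x T)" for N
  proof (induction N)
    case (Suc N)
    have "((*v) A ^^ N) (?I N x T) =
        ((*v) A ^^ N) (A *v ?I (Suc N) x T) + ((*v) A ^^ N) (B *v ?I (Suc N) u T)"
      using step[of T N] T by (simp add: linear_add[OF linear_matrix_iterate])
    with Suc show ?case by (simp add: funpow_swap1)
  qed simp
  obtain \<kappa> where \<kappa>: "0 < \<kappa>" "\<And>(A :: real ^ 'n ^ 'n) x. norm (A *v x) \<le> \<kappa> * norm A * norm x"
    using matrix_vector_bound by blast
  \<comment> \<open>The factorial from the N-fold integration beats the N-th power of the norm of
    \<open>A\<close>.\<close>
  have "norm (((*v) A ^^ N) (?I N x T)) \<le> K * (((\<kappa> * norm A) * T) ^ N / fact N)" for N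
  proof -
    have "norm (((*v) A ^^ N) (?I N x T)) \<le> norm (?I N x T) * (\<kappa> * norm A) ^ N"
      using \<kappa> by (intro matrix_iterate_bound) auto
    also have "\<dots> \<le> (K * (T ^ N / fact N)) * (\<kappa> * norm A) ^ N"
      using iterated_integral_bound(2)[OF cx K, of T N] T \<kappa>(1) by (intro mult_right_mono) auto
    finally show ?thesis by (simp add: power_mult_distrib mult_ac)
  qed
  then have "(\<lambda>N. ((*v) A ^^ N) (?I N x T)) \<longlonglongrightarrow> 0"
    by (intro Lim_null_comparison[OF always_eventually summable_LIMSEQ_zero[OF summable_exp_bound]]) auto
  then have "(\<lambda>N. x T - ((*v) A ^^ N) (?I N x T)) \<longlonglongrightarrow> x T - 0"
    by (intro tendsto_intros)
  moreover have "(\<Sum>k<N. ((*v) A ^^ k) (B *v ?I (Suc k) u T)) = x T - ((*v) A ^^ N) (?I N x T)" for N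
    using expand[of N] by (simp add: algebra_simps)
  ultimately show ?thesis by (simp add: sums_def)
qed

context prob_space
begin

context
  fixes A :: "'a \<Rightarrow> real ^ 'n ^ 'n" and B :: "'a \<Rightarrow> real ^ 'm ^ 'n"
  assumes A: "A \<in> Linfty M" and B: "B \<in> Linfty M"
begin

text \<open>Steer from rest to the target \<open>w\<close> itself. The average reached is a
  convergent series of linear combinations of moments, so \<open>w\<close> is orthogonal to it, that
  is, to itself.\<close>

lemma averaged_controllableD:
  assumes ac: "averaged_controllable M A B" and w: "\<And>k i. w \<bullet> moment M A B k i = 0"
  shows "w = 0"
proof -
  have "(\<lambda>_. 0 :: real ^ 'n) \<in> Linfty M" by (auto simp: Linfty_def)
  from ac[unfolded averaged_controllable_def, rule_format, OF this zero_less_one, of w]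
  obtain u x where u: "admissible_control u" and x: "ensemble_solution A B u (\<lambda>_. 0) x"
      and xi: "has_bochner_integral M (x 1) w"
    by blast
  have ui: "u absolutely_integrable_on {0..1}" using u by (simp add: admissible_control_def)
  \<comment> \<open>These vectors depend on the control but not on \<sigma>, which is why averaging
    the series produces moments.\<close>
  define c where "c k = iterated_integral (Suc k) u 1" for k
  have ser: "(\<lambda>k. ((*v) (A \<sigma>) ^^ k) (B \<sigma> *v c k)) sums x 1 \<sigma>" for \<sigma>
    unfolding c_def
  proof (rule solution_series[OF _ ui])
    show "(\<lambda>s. A \<sigma> *v x s \<sigma> + B \<sigma> *v u s) absolutely_integrable_on {0..t}" if "0 \<le> t" for t
      using x that by (simp add: ensemble_solution_def)
    show "x t \<sigma> = integral {0..t} (\<lambda>s. A \<sigma> *v x s \<sigma> + B \<sigma> *v u s)" if "0 \<le> t" for t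
      using x that by (simp add: ensemble_solution_def)
  qed simp
  obtain C where C: "1 \<le> C" "AE \<sigma> in M. \<forall>v k. norm (((*v) (A \<sigma>) ^^ k) v) \<le> norm v * C ^ k"
    using iterate_AE_bound[OF A B] by blast
  obtain D where D: "0 \<le> D" "AE \<sigma> in M. \<forall>x. norm (B \<sigma> *v x) \<le> D * norm x"
    using Linfty_matrix_bound[OF B] by blast
  have cu: "continuous_on {0..1} (\<lambda>t. integral {0..t} u)"
    using set_lebesgue_integral_eq_integral(1)[OF ui] by (intro indefinite_integral_continuous_1) auto
  have "compact ((\<lambda>t. integral {0..t} u) ` {0..1})" using cu by (intro compact_continuous_image) auto
  then obtain K where K: "\<And>t. t \<in> {0..1} \<Longrightarrow> norm (integral {0..t} u) \<le> K"
    using compact_imp_bounded bounded_iff by (metis imageI)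
  have c: "norm (c k) \<le> K * (1 ^ k / fact k)" for k
    unfolding c_def iterated_integral_Suc' by (rule iterated_integral_bound(2)[OF cu K]) simp_all
  note [measurable] = measurable_ensemble[OF A B]
  let ?g = "\<lambda>k \<sigma>. ((*v) (A \<sigma>) ^^ k) (B \<sigma> *v c k)"
  have meas: "?g k \<in> borel_measurable M" for k by measurable
  have ae: "AE \<sigma> in M. norm (?g k \<sigma>) \<le> (D * K) * (C ^ k / fact k)" for k
    using C(2) D(2)
  proof eventually_elim
    case (elim \<sigma>)
    have "norm (?g k \<sigma>) \<le> norm (B \<sigma> *v c k) * C ^ k" using elim by blast
    also have "\<dots> \<le> (D * norm (c k)) * C ^ k"
      using C(1) by (intro mult_right_mono spec[OF elim(2)]) auto
    also have "\<dots> \<le> (D * (K * (1 ^ k / fact k))) * C ^ k"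
      using C(1) D(1) c by (intro mult_right_mono mult_left_mono) auto
    finally show ?case by simp
  qed
  have "(\<lambda>\<sigma>. \<Sum>k. ?g k \<sigma>) = x 1" using sums_unique[OF ser] by (simp add: fun_eq_iff)
  with has_bochner_integral_series[OF meas ae summable_exp_bound]
  have xg: "has_bochner_integral M (x 1) (\<Sum>k. \<integral>\<sigma>. ?g k \<sigma> \<partial>M)" "summable (\<lambda>k. \<integral>\<sigma>. ?g k \<sigma> \<partial>M)"
    by (simp_all only:)
  have "w \<bullet> (\<integral>\<sigma>. ?g k \<sigma> \<partial>M) = 0" for k
  proof -
    have int: "integrable M (\<lambda>\<sigma>. ((*v) (A \<sigma>) ^^ k) (B \<sigma> *v axis i 1))" for i
    proof (rule integrable_const_bound)
      show "AE \<sigma> in M. norm (((*v) (A \<sigma>) ^^ k) (B \<sigma> *v axis i 1)) \<le> D * C ^ k"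
        using C(2) D(2)
      proof eventually_elim
        case (elim \<sigma>)
        have "norm (((*v) (A \<sigma>) ^^ k) (B \<sigma> *v axis i 1)) \<le> norm (B \<sigma> *v axis i 1) * C ^ k"
          using elim by blast
        also have "\<dots> \<le> (D * norm (axis i 1 :: real ^ 'm)) * C ^ k"
          using C(1) by (intro mult_right_mono spec[OF elim(2)]) auto
        finally show ?case by (simp add: norm_axis_1)
      qed
    qed measurable
    have "?g k \<sigma> = (\<Sum>i\<in>UNIV. c k $ i *\<^sub>R ((*v) (A \<sigma>) ^^ k) (B \<sigma> *v axis i 1))" for \<sigma>
    proof -
      have "(\<Sum>i\<in>UNIV. c k $ i *\<^sub>R axis i 1) = c k"
        using basis_expansion[of "c k"] by (simp only: scalar_mult_eq_scaleR)
      then have "B \<sigma> *v c k = B \<sigma> *v (\<Sum>i\<in>UNIV. c k $ i *\<^sub>R axis i 1)"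
        by (simp only:)
      also have "\<dots> = (\<Sum>i\<in>UNIV. c k $ i *\<^sub>R (B \<sigma> *v axis i 1))"
        by (simp add: linear_sum[OF matrix_vector_mul_linear] matrix_vector_mult_scaleR)
      finally show ?thesis
        by (simp only: linear_sum[OF linear_matrix_iterate] linear_cmul[OF linear_matrix_iterate])
    qed
    then have "(\<integral>\<sigma>. ?g k \<sigma> \<partial>M) = (\<integral>\<sigma>. (\<Sum>i\<in>UNIV. c k $ i *\<^sub>R ((*v) (A \<sigma>) ^^ k) (B \<sigma> *v axis i 1)) \<partial>M)"
      by (intro Bochner_Integration.integral_cong refl)
    also have "\<dots> = (\<Sum>i\<in>UNIV. c k $ i *\<^sub>R moment M A B k i)"
      unfolding moment_def using int by simp
    finally have "(\<integral>\<sigma>. ?g k \<sigma> \<partial>M) = (\<Sum>i\<in>UNIV. c k $ i *\<^sub>R moment M A B k i)" .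
    then show ?thesis by (simp only: inner_sum_right inner_scaleR_right w mult_zero_right sum.neutral_const)
  qed
  then have "w \<bullet> (\<Sum>k. \<integral>\<sigma>. ?g k \<sigma> \<partial>M) = 0"
    using bounded_linear.suminf[OF bounded_linear_inner_right[of w] xg(2)] by simp
  moreover have "(\<Sum>k. \<integral>\<sigma>. ?g k \<sigma> \<partial>M) = w"
    using xg(1) xi by (rule has_bochner_integral_eq)
  ultimately show ?thesis by (simp only: inner_eq_zero_iff)
qed

end

end

section \<open>Necessity\<close>

text \<open>A nonzero entry requires a nonzero product of matrix entries along some walk; the edge
  leaving the input is the extra one in \<open>Suc k\<close>.\<close>

lemma iterate_nonzero_imp_walk:
  fixes A :: "real ^ 'n ^ 'n" and B :: "real ^ 'm ^ 'n" and R :: "('n, 'm) node rel"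
  assumes A: "\<And>j k. A $ j $ k \<noteq> 0 \<Longrightarrow> (State k, State j) \<in> R"
    and B: "\<And>j i. B $ j $ i \<noteq> 0 \<Longrightarrow> (Input i, State j) \<in> R"
    and nz: "((*v) A ^^ k) (B *v axis i 1) $ j \<noteq> 0"
  shows "(Input i, State j) \<in> R ^^ Suc k"
  using nz
proof (induction k arbitrary: j)
  case 0
  then have "B $ j $ i \<noteq> 0" by (simp add: matrix_vector_mult_basis column_def)
  then have "(Input i, State j) \<in> R" by (rule B)
  then show ?case by simp
next
  case (Suc k)
  have comp: "(A *v x) $ j = (\<Sum>l\<in>UNIV. A $ j $ l * x $ l)" for x
    by (simp add: matrix_vector_mult_def)
  have "(\<Sum>l\<in>UNIV. A $ j $ l * ((*v) A ^^ k) (B *v axis i 1) $ l) \<noteq> 0"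
    using Suc.prems by (simp add: comp)
  then obtain l where "A $ j $ l \<noteq> 0" "((*v) A ^^ k) (B *v axis i 1) $ l \<noteq> 0"
    by (metis (no_types, lifting) mult_eq_0_iff sum.not_neutral_contains_not_neutral)
  with A Suc.IH show ?case by (blast intro: relpow_Suc_I)
qed

lemma integral_vec_nth_zero:
  fixes f :: "'a \<Rightarrow> real ^ 'n"
  assumes "AE \<sigma> in M. f \<sigma> $ j = 0"
  shows "(\<integral>\<sigma>. f \<sigma> \<partial>M) $ j = 0"
proof (cases "integrable M f")
  case True
  have "(\<integral>\<sigma>. f \<sigma> \<partial>M) $ j = (\<integral>\<sigma>. f \<sigma> $ j \<partial>M)"
    using integral_bounded_linear[OF bounded_linear_vec_nth True, of j] by simp
  also have "\<dots> = 0" using assms by (rule integral_eq_zero_AE)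
  finally show ?thesis .
\<comment> \<open>The Bochner integral of a non-integrable function is 0 by convention.\<close>
qed (simp add: not_integrable_integral_eq)

lemma moment_nonzero_imp_walk:
  fixes G :: "('n::finite, 'm::finite) node pair_pre_digraph"
  assumes c: "compliant M G A B" and nz: "moment M A B k i $ j \<noteq> 0"
  shows "(Input i, State j) \<in> parcs G ^^ Suc k"
proof (rule ccontr)
  assume nw: "(Input i, State j) \<notin> parcs G ^^ Suc k"
  have "AE \<sigma> in M. \<forall>j k. (State k, State j) \<notin> parcs G \<longrightarrow> A \<sigma> $ j $ k = 0"
    using c by (simp add: compliant_def AE_all_countable)
  moreover have "AE \<sigma> in M. \<forall>j i. (Input i, State j) \<notin> parcs G \<longrightarrow> B \<sigma> $ j $ i = 0"
    using c by (simp add: compliant_def AE_all_countable)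
  ultimately have "AE \<sigma> in M. ((*v) (A \<sigma>) ^^ k) (B \<sigma> *v axis i 1) $ j = 0"
  proof eventually_elim
    case (elim \<sigma>)
    then show ?case using iterate_nonzero_imp_walk[of "A \<sigma>" "parcs G" "B \<sigma>" k i j] nw by blast
  qed
  from integral_vec_nth_zero[OF this] nz show False by (simp add: moment_def)
qed

text \<open>A nonzero term of the Leibniz expansion yields the transversal.\<close>

lemma spanning_family_transversal:
  fixes v :: "'c \<Rightarrow> real ^ 'n"
  assumes full: "\<And>w. (\<And>c. w \<bullet> v c = 0) \<Longrightarrow> w = 0"
  obtains c :: "'n \<Rightarrow> 'c" where "inj c" "\<And>j. v (c j) $ j \<noteq> 0"
proof -
  have span: "span (range v) = UNIV"
  proof (rule ccontr)
    assume "span (range v) \<noteq> UNIV"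
    then have "dim (range v) < DIM(real ^ 'n)"
      using dim_eq_full[of "range v"] dim_subset_UNIV[of "range v"] by simp
    then obtain w where "w \<noteq> 0" "\<And>x. x \<in> span (range v) \<Longrightarrow> orthogonal w x"
      using orthogonal_to_subspace_exists[of "range v"] by blast
    then have "w \<bullet> v c = 0" for c by (simp add: orthogonal_def span_base)
    with full \<open>w \<noteq> 0\<close> show False by blast
  qed
  obtain b where b: "b \<subseteq> range v" "independent b" "range v \<subseteq> span b" "card b = dim (range v)"
    by (rule basis_exists)
  have span_b: "span b = UNIV"
    using span_minimal[OF b(3) subspace_span] span by auto
  have "dim (range v) = CARD('n)" using span dim_eq_full[of "range v"] by simp
  moreover have "finite b" using b(2) by (rule independent_imp_finite)
  ultimately obtain e where e: "bij_betw e (UNIV :: 'n set) b"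
    using b(4) finite_same_card_bij[of "UNIV :: 'n set" b] by auto
  define N :: "real ^ 'n ^ 'n" where "N = (\<chi> j l. e l $ j)"
  have "columns N = b"
    using e by (auto simp: columns_def column_def N_def bij_betw_def)
  then have "\<exists>N'. N ** N' = mat 1"
    using span_b by (simp add: matrix_right_invertible_span_columns span_vec_eq)
  then have "det N \<noteq> 0" by (metis det_I det_mul mult_zero_left zero_neq_one)
  have "\<exists>p. p permutes (UNIV :: 'n set) \<and> (\<Prod>j\<in>UNIV. N $ j $ p j) \<noteq> 0"
  proof (rule ccontr)
    assume "\<nexists>p. p permutes (UNIV :: 'n set) \<and> (\<Prod>j\<in>UNIV. N $ j $ p j) \<noteq> 0"
    then have "det N = 0" unfolding det_def by (intro sum.neutral) simp
    with \<open>det N \<noteq> 0\<close> show False by contradiction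
  qed
  then obtain p where p: "p permutes (UNIV :: 'n set)" "(\<Prod>j\<in>UNIV. N $ j $ p j) \<noteq> 0" by blast
  have nz: "e (p j) $ j \<noteq> 0" for j using p(2) by (simp add: N_def)
  have "e l \<in> range v" for l using e b(1) by (auto simp: bij_betw_def)
  then have "\<forall>l. \<exists>c. v c = e l" by (auto simp: image_iff) metis
  then obtain g where g: "\<And>l. v (g l) = e l" by metis
  have "inj g" using g e by (intro injI) (metis bij_betw_imp_inj_on injD)
  moreover have "inj p" using p(1) by (rule permutes_inj)
  ultimately have "inj (g \<circ> p)" by (rule inj_compose)
  moreover have "v ((g \<circ> p) j) $ j \<noteq> 0" for j using nz g by simp
  ultimately show thesis by (rule that)
qed

lemma (in prob_space) structurally_averaged_controllableD:
  fixes G :: "('n::finite, 'm::finite) node pair_pre_digraph"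
  assumes G: "G \<in> control_digraphs" and sac: "structurally_averaged_controllable M G"
  shows "accessible G"
    "has_row_saturating_matching (pattern_rows G) (pattern_columns G) (sparsity_pattern G)"
proof -
  from sac obtain A B where c: "compliant M G A B" and ac: "averaged_controllable M A B"
    unfolding structurally_averaged_controllable_def by blast
  then have AB: "A \<in> Linfty M" "B \<in> Linfty M" by (simp_all add: compliant_def)
  have full: "w = 0" if "\<And>c. w \<bullet> moment M A B (fst c) (snd c) = 0" for w
  proof (rule averaged_controllableD[OF AB ac])
    show "w \<bullet> moment M A B k i = 0" for k i using that[of "(k, i)"] by simp
  qed
  obtain c' :: "'n \<Rightarrow> nat \<times> 'm" where c': "inj c'"
      "\<And>j. moment M A B (fst (c' j)) (snd (c' j)) $ j \<noteq> 0"
    using spanning_family_transversal[of "\<lambda>c. moment M A B (fst c) (snd c)", OF full] by blast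
  have walk: "(Input (snd (c' j)), State j) \<in> parcs G ^^ Suc (fst (c' j))" for j
    using moment_nonzero_imp_walk[OF c c'(2)] .
  then show "accessible G"
    unfolding accessible_iff[OF G] by (blast intro: relpow_imp_rtrancl)
  show "has_row_saturating_matching (pattern_rows G) (pattern_columns G) (sparsity_pattern G)"
    unfolding row_saturating_matching_iff[OF G finite]
  proof (intro exI conjI ballI)
    \<comment> \<open>Moment k belongs to walks of k + 1 edges, hence the successor in the column
      length.\<close>
    show "inj_on (\<lambda>j. (Suc (fst (c' j)), snd (c' j))) (core_states G)"
      using c'(1) by (auto simp: inj_def intro!: inj_onI prod_eqI)
  qed (use walk in simp)
qed

section \<open>Disjoint sets of positive measure\<close>

text \<open>If no basic open set splits \<open>V\<close>, each of them cuts off a null part of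
  \<open>V\<close>, either inside or outside. Removing these countably many null parts leaves at
  most one point, which is null as well.\<close>

lemma split_positive_set:
  fixes \<mu> :: "'a::{second_countable_topology, t2_space} measure"
  assumes sets: "sets \<mu> = sets borel" and V: "V \<in> sets \<mu>" "emeasure \<mu> V \<noteq> 0"
    and null: "\<And>x. x \<in> V \<Longrightarrow> emeasure \<mu> {x} = 0"
  obtains Q where "open Q" "emeasure \<mu> (V \<inter> Q) \<noteq> 0" "emeasure \<mu> (V - Q) \<noteq> 0"
proof (rule ccontr)
  assume neg: "\<not> thesis"
  note split = that
  obtain \<B> :: "'a set set" where \<B>: "countable \<B>" "topological_basis \<B>"
    using ex_countable_basis by blast
  have op: "open Q" if "Q \<in> \<B>" for Q using \<B>(2) that by (rule topological_basis_open)
  have dich: "emeasure \<mu> (V \<inter> Q) = 0 \<or> emeasure \<mu> (V - Q) = 0" if "Q \<in> \<B>" for Q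
    using split[OF op[OF that]] neg by blast
  define N where "N = (\<Union>Q\<in>{Q\<in>\<B>. emeasure \<mu> (V \<inter> Q) = 0}. V \<inter> Q) \<union>
    (\<Union>Q\<in>{Q\<in>\<B>. emeasure \<mu> (V - Q) = 0}. V - Q)"
  have meas: "V \<inter> Q \<in> sets \<mu>" "V - Q \<in> sets \<mu>" if "Q \<in> \<B>" for Q
    using V(1) borel_open[OF op[OF that]] unfolding sets[symmetric] by (auto intro: sets.Int sets.Diff)
  have N0: "N \<in> null_sets \<mu>"
    unfolding N_def
  proof (intro null_sets.Un null_sets_UN')
    show "countable {Q \<in> \<B>. emeasure \<mu> (V \<inter> Q) = 0}" "countable {Q \<in> \<B>. emeasure \<mu> (V - Q) = 0}"
      using \<B>(1) by (auto intro: countable_subset[rotated])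
  qed (use meas in \<open>simp_all add: null_sets_def\<close>)
  have "V \<noteq> N" using V(2) N0 by auto
  moreover have "N \<subseteq> V" by (auto simp: N_def)
  ultimately obtain x where x: "x \<in> V" "x \<notin> N" by blast
  \<comment> \<open>Of two surviving points one would be removed, because some basic open set
    contains \<open>x\<close> but not \<open>y\<close>.\<close>
  have "V \<subseteq> N \<union> {x}"
  proof
    fix y assume y: "y \<in> V"
    show "y \<in> N \<union> {x}"
    proof (rule ccontr)
      assume ny: "y \<notin> N \<union> {x}"
      then have "x \<noteq> y" by blast
      then obtain U where U: "open U" "x \<in> U" "y \<notin> U" using t1_space[of x y] by blast
      obtain Q where Q: "Q \<in> \<B>" "x \<in> Q" "Q \<subseteq> U"
        using topological_basisE[OF \<B>(2) U(1,2)] by blast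
      from dich[OF Q(1)] show False
      proof
        assume "emeasure \<mu> (V \<inter> Q) = 0"
        with Q(1) have "V \<inter> Q \<subseteq> N" unfolding N_def by (intro le_supI1 UN_upper) simp
        with x Q(2) show False by auto
      next
        assume "emeasure \<mu> (V - Q) = 0"
        with Q(1) have "V - Q \<subseteq> N" unfolding N_def by (intro le_supI2 UN_upper) simp
        with y ny Q(3) U(3) show False by auto
      qed
    qed
  qed
  moreover have "{x} \<in> null_sets \<mu>" using null[OF x(1)] by (simp add: null_sets_def sets)
  with N0 have "N \<union> {x} \<in> null_sets \<mu>" by (rule null_sets.Un)
  ultimately have "V \<in> null_sets \<mu>" using null_sets_subset[of "N \<union> {x}" \<mu> V] V(1) by simp
  with V(2) show False by (simp add: null_sets_def)
qed

text \<open>One half of a splitting goes to the new index; the other half is again a set of positive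
  measure whose points are null, and is left to the induction.\<close>

lemma disjoint_positive_sets:
  fixes \<mu> :: "'a::{second_countable_topology, t2_space} measure"
  assumes sets: "sets \<mu> = sets borel" and "V \<in> sets \<mu>" "emeasure \<mu> V \<noteq> 0"
    and "\<And>x. x \<in> V \<Longrightarrow> emeasure \<mu> {x} = 0" and fin: "finite I"
  shows "\<exists>P. disjoint_family_on P I \<and> (\<forall>i\<in>I. P i \<in> sets \<mu> \<and> P i \<subseteq> V \<and> emeasure \<mu> (P i) \<noteq> 0)"
  using fin assms(2-4)
proof (induction I arbitrary: V rule: finite_induct)
  case empty
  then show ?case by (auto simp: disjoint_family_on_def)
next
  case (insert i I)
  obtain Q where Q: "open Q" "emeasure \<mu> (V \<inter> Q) \<noteq> 0" "emeasure \<mu> (V - Q) \<noteq> 0"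
    by (rule split_positive_set[OF sets insert.prems])
  have m: "V \<inter> Q \<in> sets \<mu>" "V - Q \<in> sets \<mu>" using insert.prems(1) Q(1) sets by auto
  obtain P where P: "disjoint_family_on P I"
      "\<And>j. j \<in> I \<Longrightarrow> P j \<in> sets \<mu> \<and> P j \<subseteq> V \<inter> Q \<and> emeasure \<mu> (P j) \<noteq> 0"
    using insert.IH[OF m(1) Q(2) insert.prems(3)] by blast
  show ?case
  proof (intro exI[of _ "P(i := V - Q)"] conjI)
    show "disjoint_family_on (P(i := V - Q)) (insert i I)"
    proof -
      have "(V - Q) \<inter> P j = {}" if "j \<in> I" for j using P(2)[OF that] by blast
      moreover have "P j \<inter> P k = {}" if "j \<in> I" "k \<in> I" "j \<noteq> k" for j k
        using P(1) that by (rule disjoint_family_onD)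
      ultimately have "(P(i := V - Q)) m \<inter> (P(i := V - Q)) n = {}"
        if "m \<in> insert i I" "n \<in> insert i I" "m \<noteq> n" for m n
        using insert.hyps(2) that by (cases "m = i"; cases "n = i") (simp_all add: Int_commute)
      then show ?thesis unfolding disjoint_family_on_def by blast
    qed
    show "\<forall>j\<in>insert i I. (P(i := V - Q)) j \<in> sets \<mu> \<and> (P(i := V - Q)) j \<subseteq> V \<and>
        emeasure \<mu> ((P(i := V - Q)) j) \<noteq> 0"
      using P(2) insert.hyps(2) Q m by auto
  qed
qed

text \<open>In a chart around x the measure has a density with respect to Lebesgue measure, and by
  injectivity of the chart \<open>{x}\<close> is the preimage of a single point.\<close>

lemma smooth_volume_measure_singleton:
  fixes \<A> :: "('a::{second_countable_topology, t2_space} set \<times> ('a \<Rightarrow> real ^ 'd)) set"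
  assumes "smooth_atlas \<A>" "open W" "smooth_volume_measure \<A> W \<nu>" "x \<in> W"
  shows "{x} \<in> null_sets \<nu>"
proof -
  have "(\<Union>c\<in>\<A>. fst c) = UNIV" using assms(1) by (simp add: smooth_atlas_def)
  then obtain c where "c \<in> \<A>" "x \<in> fst c" by blast
  then obtain U \<phi> where U: "(U, \<phi>) \<in> \<A>" "x \<in> U" by (cases c) simp
  then have "is_chart (U, \<phi>)" using assms(1) unfolding smooth_atlas_def by blast
  then obtain \<psi> where oU: "open U" and \<psi>: "homeomorphism U (\<phi> ` U) \<phi> \<psi>"
    unfolding is_chart_def prod.case by blast
  have sp: "space \<nu> = W" and st: "sets \<nu> = sets (restrict_space borel W)"
    using assms(3) unfolding smooth_volume_measure_def by blast+
  obtain \<rho> :: "real ^ 'd \<Rightarrow> real" where \<rho>: "distr (restrict_space \<nu> (U \<inter> W)) borel \<phi> =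
      density lborel (\<lambda>y. ennreal (\<rho> y) * indicator (\<phi> ` (U \<inter> W)) y)"
    using bspec[OF conjunct2[OF conjunct2[OF assms(3)[unfolded smooth_volume_measure_def]]] U(1)]
    by (simp only: prod.case) blast
  have UW: "U \<inter> W \<in> sets \<nu>" using oU assms(2) by (auto simp: st sets_restrict_space)
  have spr: "space (restrict_space \<nu> (U \<inter> W)) = U \<inter> W" using sp by (auto simp: space_restrict_space)
  have str: "sets (restrict_space \<nu> (U \<inter> W)) = sets (restrict_space borel (U \<inter> W))"
  proof -
    have "sets (restrict_space \<nu> (U \<inter> W)) = sets (restrict_space (restrict_space borel W) (U \<inter> W))"
      by (rule sets_restrict_space_cong[OF st])
    also have "restrict_space (restrict_space borel W) (U \<inter> W) = restrict_space borel (W \<inter> (U \<inter> W))"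
      using assms(2) oU by (intro restrict_restrict_space) auto
    also have "W \<inter> (U \<inter> W) = U \<inter> W" by blast
    finally show ?thesis .
  qed
  have "continuous_on (U \<inter> W) \<phi>"
    using homeomorphism_cont1[OF \<psi>] by (rule continuous_on_subset) simp
  then have "\<phi> \<in> borel_measurable (restrict_space borel (U \<inter> W))"
    by (rule borel_measurable_continuous_on_restrict)
  then have \<phi>m: "\<phi> \<in> borel_measurable (restrict_space \<nu> (U \<inter> W))"
    by (simp only: measurable_cong_sets[OF str refl])
  have "inj_on \<phi> U" using homeomorphism_apply1[OF \<psi>] by (rule inj_on_inverseI)
  then have pre: "\<phi> -` {\<phi> x} \<inter> space (restrict_space \<nu> (U \<inter> W)) = {x}"
    using U(2) assms(4) by (auto simp: spr dest: inj_onD)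
  have "emeasure \<nu> {x} = emeasure (restrict_space \<nu> (U \<inter> W)) {x}"
    using U(2) assms(4) UW by (subst emeasure_restrict_space) (auto simp: sp)
  also have "\<dots> = emeasure (distr (restrict_space \<nu> (U \<inter> W)) borel \<phi>) {\<phi> x}"
    using \<phi>m by (simp add: emeasure_distr pre)
  also have "\<dots> = 0"
  proof -
    have "AE y in lborel. y \<noteq> \<phi> x" by (rule AE_lborel_singleton)
    then have ae: "AE y in lborel. (ennreal (\<rho> y) * indicator (\<phi> ` (U \<inter> W)) y) * indicator {\<phi> x} y = 0"
      by eventually_elim simp
    show ?thesis
      unfolding \<rho> density_def emeasure_measure_of_conv using nn_integral_cong_AE[OF ae] by simp
  qed
  finally have "emeasure \<nu> {x} = 0" .
  moreover have "{x} \<in> sets \<nu>"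
    unfolding st sets_restrict_space using assms(4) by (intro image_eqI[of _ _ "{x}"]) auto
  ultimately show ?thesis by (simp add: null_sets_def)
qed

section \<open>Sufficiency\<close>

text \<open>Solve for the term of \<open>h\<close> and divide by \<open>Z ^ ((r h - 1) * k)\<close>.
  Ranks are integers, so every other power of Z is at most this one, while the term of
  \<open>h\<close> keeps a factor \<open>Z ^ k\<close>.\<close>

lemma dominant_term_bound:
  fixes Z Y :: real and r :: "'b \<Rightarrow> nat"
  assumes fin: "finite H" and h: "h \<in> H" and r: "\<And>h'. h' \<in> H \<Longrightarrow> h' \<noteq> h \<Longrightarrow> r h' < r h"
    and p: "\<And>h'. h' \<in> H \<Longrightarrow> 0 \<le> p h'" "sum p H \<le> 1" and Z: "1 \<le> Z"
    and y: "\<And>h'. h' \<in> H \<Longrightarrow> \<bar>y h'\<bar> \<le> Y"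
    and zero: "(\<Sum>h'\<in>H. p h' * Z ^ (r h' * k) * y h') = 0"
  shows "p h * Z ^ k * \<bar>y h\<bar> \<le> Y"
\<comment> \<open>A lone \<open>h\<close> may have rank 0, where \<open>r h - 1\<close> would be
  truncated; a second element forces \<open>1 \<le> r h\<close>.\<close>
proof (cases "H = {h}")
  case True
  with zero Z have "p h * y h = 0" by simp
  then have "p h * Z ^ k * \<bar>y h\<bar> = 0" by (cases "p h = 0") simp_all
  then show ?thesis using y[OF h] by linarith
next
  case False
  with h obtain h1 where "h1 \<in> H" "h1 \<noteq> h" by blast
  then have r1: "1 \<le> r h" using r[of h1] by simp
  define a where "a = Z ^ ((r h - 1) * k)"
  have a: "0 < a" using Z by (simp add: a_def)
  have Y0: "0 \<le> Y" using y[OF h] by linarith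
  have split: "p h * Z ^ (r h * k) * y h = - (\<Sum>h'\<in>H - {h}. p h' * Z ^ (r h' * k) * y h')"
    using zero sum.remove[OF fin h, of "\<lambda>h'. p h' * Z ^ (r h' * k) * y h'"] by linarith
  have rk: "r h * k = k + (r h - 1) * k"
    using r1 by (cases "r h") simp_all
  have Zrk: "Z ^ (r h * k) = a * Z ^ k"
    unfolding rk power_add a_def by (simp add: mult.commute)
  have "a * (p h * Z ^ k * \<bar>y h\<bar>) = \<bar>p h * Z ^ (r h * k) * y h\<bar>"
    using p(1)[OF h] Z a by (simp add: Zrk abs_mult)
  also have "\<dots> \<le> (\<Sum>h'\<in>H - {h}. \<bar>p h' * Z ^ (r h' * k) * y h'\<bar>)"
    unfolding split abs_minus_cancel by (rule sum_abs)
  also have "\<dots> \<le> (\<Sum>h'\<in>H - {h}. p h' * (a * Y))"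
  proof (rule sum_mono)
    fix h' assume h': "h' \<in> H - {h}"
    have "Z ^ (r h' * k) \<le> a"
      unfolding a_def using r[of h'] h' Z by (intro power_increasing mult_right_mono) auto
    then have "Z ^ (r h' * k) * \<bar>y h'\<bar> \<le> a * Y"
      using y[of h'] h' Z Y0 a by (intro mult_mono) auto
    then have "p h' * (Z ^ (r h' * k) * \<bar>y h'\<bar>) \<le> p h' * (a * Y)"
      using p(1)[of h'] h' by (intro mult_left_mono) auto
    then show "\<bar>p h' * Z ^ (r h' * k) * y h'\<bar> \<le> p h' * (a * Y)"
      using p(1)[of h'] h' Z by (simp add: abs_mult mult.assoc)
  qed
  also have "\<dots> = sum p (H - {h}) * (a * Y)" by (simp add: sum_distrib_right)
  also have "\<dots> \<le> 1 * (a * Y)"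
  proof (rule mult_right_mono)
    have "sum p (H - {h}) \<le> sum p H" using fin p(1) by (intro sum_mono2) auto
    with p(2) show "sum p (H - {h}) \<le> 1" by linarith
  qed (use a Y0 in simp)
  finally show ?thesis using a by simp
qed

text \<open>The pieces carry weights \<open>p h\<close> and gains \<open>Z ^ r h\<close> of well separated
  magnitudes, so a vanishing sum forces its dominant term to be small.  For large
  \<open>k\<close> only the recurrent pieces (those outside \<open>C\<close>) contribute, which
  eliminates \<open>w\<close> outside \<open>C\<close>; what is left is diagonally dominant.\<close>

lemma separated_gains_imp_zero:
  fixes S :: "'n::finite \<Rightarrow> nat \<Rightarrow> 'n set" and w p :: "'n \<Rightarrow> real" and inp :: "'n \<Rightarrow> 'i"
    and r len \<delta> :: "'n \<Rightarrow> nat" and Z :: real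
  assumes core: "\<And>h. h \<in> C \<Longrightarrow> S h (len h) = {h}" "\<And>h k. h \<in> C \<Longrightarrow> len h < k \<Longrightarrow> S h k = {}"
      "\<And>h. h \<in> C \<Longrightarrow> 1 \<le> len h"
    and inj_core: "\<And>h h'. h \<in> C \<Longrightarrow> h' \<in> C \<Longrightarrow> inp h = inp h' \<Longrightarrow> len h = len h' \<Longrightarrow> h = h'"
    and rec: "\<And>h K. h \<notin> C \<Longrightarrow> \<exists>k\<ge>K. h \<in> S h k \<and> (\<forall>v\<in>S h k. v \<noteq> h \<longrightarrow> v \<notin> C \<and> \<delta> v < \<delta> h)"
    and r: "inj r" "\<And>h h'. h \<in> C \<Longrightarrow> h' \<notin> C \<Longrightarrow> r h' < r h"
      "\<And>h h'. h \<in> C \<Longrightarrow> h' \<in> C \<Longrightarrow> len h < len h' \<Longrightarrow> r h' < r h"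
    and p: "\<And>h. 0 < p h" "sum p UNIV \<le> 1" and Z: "1 < Z" "\<And>h. CARD('n) < p h * Z"
    and zero: "\<And>k i. 1 \<le> k \<Longrightarrow> (\<Sum>h | inp h = i. p h * Z ^ (r h * k) * (\<Sum>v\<in>S h k. w v)) = 0"
  shows "w v = 0"
proof -
  define y where "y h k = (\<Sum>v\<in>S h k. w v)" for h k
  \<comment> \<open>With the vanishing terms discarded, the rank of \<open>h\<close> has to beat
    only the pieces with the same input that contribute at length k.\<close>
  have dominant: "p h * Z ^ k * \<bar>y h k\<bar> \<le> Y"
    if k: "1 \<le> k" and h: "\<And>h'. inp h' = inp h \<Longrightarrow> y h' k \<noteq> 0 \<Longrightarrow> h' \<noteq> h \<Longrightarrow> r h' < r h"
      and Y: "\<And>h'. \<bar>y h' k\<bar> \<le> Y" for h k Y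
  proof (cases "y h k = 0")
    case True
    then show ?thesis using Y[of h] by simp
  next
    case False
    define H where "H = {h'. inp h' = inp h \<and> y h' k \<noteq> 0}"
    have "(\<Sum>h'\<in>H. p h' * Z ^ (r h' * k) * y h' k) = (\<Sum>h' | inp h' = inp h. p h' * Z ^ (r h' * k) * y h' k)"
      by (rule sum.mono_neutral_left) (auto simp: H_def)
    also have "\<dots> = 0" using zero[OF k, of "inp h"] by (simp add: y_def)
    finally have z: "(\<Sum>h'\<in>H. p h' * Z ^ (r h' * k) * y h' k) = 0" .
    have "sum p H \<le> sum p UNIV" using p(1) by (intro sum_mono2) (auto intro: less_imp_le)
    then have "sum p H \<le> 1" using p(2) by linarith
    moreover have "h \<in> H" using False by (simp add: H_def)
    ultimately show ?thesis
      using z Z(1) p(1) h Y by (intro dominant_term_bound[of H h r p Z "\<lambda>h. y h k" Y k]) (auto simp: H_def less_imp_le)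
  qed
  define M where "M = (\<Sum>v\<in>UNIV. \<bar>w v\<bar>)"
  have yM: "\<bar>y h k\<bar> \<le> M" for h k
  proof -
    have "\<bar>y h k\<bar> \<le> (\<Sum>v\<in>S h k. \<bar>w v\<bar>)" unfolding y_def by (rule sum_abs)
    also have "\<dots> \<le> M" unfolding M_def by (intro sum_mono2) auto
    finally show ?thesis .
  qed
  have M0: "0 \<le> M" unfolding M_def by (simp add: sum_nonneg)
  \<comment> \<open>The sums run over subsets of a finite set, so the nonzero ones are bounded away
    from 0 uniformly in k. The inserted 1 keeps \<open>E\<close> nonempty.\<close>
  obtain \<epsilon> where \<epsilon>: "0 < \<epsilon>" "\<And>h k. y h k \<noteq> 0 \<Longrightarrow> \<epsilon> \<le> \<bar>y h k\<bar>"
  proof -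
    define E where "E = insert 1 ((\<lambda>U. \<bar>\<Sum>v\<in>U. w v\<bar>) ` {U. (\<Sum>v\<in>U. w v) \<noteq> 0})"
    have E: "finite E" "E \<noteq> {}" by (auto simp: E_def)
    show thesis
    proof (rule that[of "Min E"])
      show "0 < Min E" using E by (auto simp: E_def Min_gr_iff)
      show "Min E \<le> \<bar>y h k\<bar>" if "y h k \<noteq> 0" for h k
        using E(1) that by (intro Min_le) (auto simp: E_def y_def)
    qed
  qed
  define pmin where "pmin = Min (range p)"
  have pmin: "0 < pmin" "\<And>h. pmin \<le> p h" using p(1) by (auto simp: pmin_def Min_gr_iff)
  obtain K where K: "M / (pmin * \<epsilon>) < Z ^ K" using real_arch_pow[OF Z(1)] by blast
  \<comment> \<open>Among the nonzero contributions with one input take the one of largest rank. Its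
    size is at least \<epsilon>, which for exponents from \<open>K\<close> on contradicts the bound
    \<open>M\<close>.\<close>
  have large: "y h k = 0" if k: "max 1 K \<le> k" for h k
  proof (rule ccontr)
    assume nz: "y h k \<noteq> 0"
    define H where "H = {h'. inp h' = inp h \<and> y h' k \<noteq> 0}"
    have "h \<in> H" using nz by (simp add: H_def)
    then have "Max (r ` H) \<in> r ` H" by (intro Max_in) auto
    then obtain h0 where "h0 \<in> H" "r h0 = Max (r ` H)" by auto
    then have h0: "h0 \<in> H" "\<And>h'. h' \<in> H \<Longrightarrow> r h' \<le> r h0" by simp_all
    have "p h0 * Z ^ k * \<bar>y h0 k\<bar> \<le> M"
    proof (rule dominant)
      fix h' assume "inp h' = inp h0" "y h' k \<noteq> 0" "h' \<noteq> h0"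
      with h0(1) have "h' \<in> H" by (simp add: H_def)
      from h0(2)[OF this] \<open>h' \<noteq> h0\<close> r(1) show "r h' < r h0" by (metis injD le_neq_implies_less)
    qed (use k yM in auto)
    moreover have "\<epsilon> \<le> \<bar>y h0 k\<bar>" using h0(1) \<epsilon>(2) by (simp add: H_def)
    then have "pmin * Z ^ k * \<epsilon> \<le> p h0 * Z ^ k * \<bar>y h0 k\<bar>"
      using pmin Z(1) \<epsilon>(1) p(1)[of h0] by (intro mult_mono) (auto intro: less_imp_le)
    moreover have "Z ^ K \<le> Z ^ k" using Z(1) k by (intro power_increasing) auto
    ultimately have "Z ^ k \<le> M / (pmin * \<epsilon>)" using pmin(1) \<epsilon>(1) by (simp add: field_simps)
    with K \<open>Z ^ K \<le> Z ^ k\<close> show False by linarith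
  qed
  have noncore: "w h = 0" if "h \<notin> C" for h
    using that
  proof (induction "\<delta> h" arbitrary: h rule: less_induct)
    case less
    obtain k where k: "max 1 K \<le> k" "h \<in> S h k" "\<And>v. v \<in> S h k \<Longrightarrow> v \<noteq> h \<Longrightarrow> v \<notin> C \<and> \<delta> v < \<delta> h"
      using rec[OF less.prems, of "max 1 K"] by blast
    have "y h k = w h + (\<Sum>v\<in>S h k - {h}. w v)"
      unfolding y_def by (rule sum.remove) (use k(2) in auto)
    \<comment> \<open>The bystanders in the layer lie outside the core and closer to the cyclic
      nodes, so \<open>w\<close> already vanishes there.\<close>
    also have "(\<Sum>v\<in>S h k - {h}. w v) = 0"
      by (intro sum.neutral ballI less.hyps) (use k(3) in auto)
    finally show ?case using large[OF k(1), of h] by simp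
  qed
  show "w v = 0"
  proof (cases "C = {}")
    case True
    then show ?thesis using noncore by simp
  next
    case False
    obtain h where h: "h \<in> C" "\<And>h'. h' \<in> C \<Longrightarrow> \<bar>w h'\<bar> \<le> \<bar>w h\<bar>"
    proof -
      have "Max ((\<lambda>h. \<bar>w h\<bar>) ` C) \<in> (\<lambda>h. \<bar>w h\<bar>) ` C" using False by (intro Max_in) auto
      then obtain h where h: "h \<in> C" "Max ((\<lambda>h. \<bar>w h\<bar>) ` C) = \<bar>w h\<bar>" by auto
      have "\<bar>w h'\<bar> \<le> \<bar>w h\<bar>" if "h' \<in> C" for h'
        unfolding h(2)[symmetric] using that by (intro Max_ge) auto
      with h(1) show thesis by (rule that)
    qed
    \<comment> \<open>Since \<open>w\<close> vanishes outside \<open>C\<close>, the largest entry on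
      \<open>C\<close> is the largest of all.\<close>
    have max: "\<bar>w h'\<bar> \<le> \<bar>w h\<bar>" for h' using h(2) noncore by (cases "h' \<in> C") auto
    let ?k = "len h"
    have "p h * Z ^ ?k * \<bar>y h ?k\<bar> \<le> CARD('n) * \<bar>w h\<bar>"
    proof (rule dominant)
      show "1 \<le> ?k" using core(3)[OF h(1)] .
      fix h'
      have "\<bar>y h' ?k\<bar> \<le> (\<Sum>v\<in>S h' ?k. \<bar>w v\<bar>)" unfolding y_def by (rule sum_abs)
      also have "\<dots> \<le> (\<Sum>v\<in>UNIV. \<bar>w v\<bar>)" by (intro sum_mono2) auto
      also have "\<dots> \<le> CARD('n) * \<bar>w h\<bar>" using max by (intro sum_bounded_above)
      finally show "\<bar>y h' ?k\<bar> \<le> CARD('n) * \<bar>w h\<bar>" .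
      assume h': "inp h' = inp h" "y h' ?k \<noteq> 0" "h' \<noteq> h"
      show "r h' < r h"
      \<comment> \<open>A shorter core path has died out at this length, an equally long one with
        the same input is excluded by the matching, and a longer one has smaller rank, as do all
        pieces outside the core.\<close>
      proof (cases "h' \<in> C")
        case True
        have "\<not> len h' < ?k" using core(2)[OF True, of ?k] h'(2) by (auto simp: y_def)
        moreover have "len h' \<noteq> ?k" using inj_core[OF True h(1) h'(1)] h'(3) by blast
        ultimately show ?thesis using r(3)[OF h(1) True] by linarith
      qed (rule r(2)[OF h(1)])
    qed
    moreover have "y h ?k = w h" by (simp add: y_def core(1)[OF h(1)])
    ultimately have le: "p h * Z ^ ?k * \<bar>w h\<bar> \<le> CARD('n) * \<bar>w h\<bar>" by simp
    have "Z ^ 1 \<le> Z ^ ?k" using Z(1) core(3)[OF h(1)] by (intro power_increasing) auto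
    then have "p h * Z \<le> p h * Z ^ ?k" using p(1)[of h] by simp
    then have "CARD('n) < p h * Z ^ ?k" using Z(2)[of h] by linarith
    then have "w h = 0" using le by (simp add: mult_le_cancel_right)
    then show ?thesis using max[of v] by simp
  qed
qed

section \<open>Moments of a piecewise constant pair\<close>

definition gain_matrix :: "real \<Rightarrow> (('n, 'm) node \<times> ('n, 'm) node) set \<Rightarrow> real ^ 'n ^ 'n" where
  "gain_matrix z F = (\<chi> j k. if (State k, State j) \<in> F then z else 0)"

text \<open>All inputs but \<open>i0\<close> are switched off, so a piece contributes to the columns
  of one input only.\<close>

definition input_matrix ::
  "real \<Rightarrow> (('n, 'm) node \<times> ('n, 'm) node) set \<Rightarrow> 'm \<Rightarrow> real ^ 'm ^ 'n" where
  "input_matrix z F i0 = (\<chi> j i. if i = i0 \<and> (Input i, State j) \<in> F then z else 0)"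

definition state_indicator :: "('n, 'm) node set \<Rightarrow> real ^ 'n" where
  "state_indicator S = (\<chi> j. if State j \<in> S then 1 else 0)"

text \<open>Unambiguity of the walks makes the number of walks of each length 0 or 1.\<close>

lemma iterate_gain_matrix:
  fixes F :: "(('n::finite, 'm::finite) node \<times> ('n, 'm) node) set"
  assumes un: "unambiguous F (Input i0)" and no_in: "\<And>u i. (u, Input i) \<notin> F"
  shows "((*v) (gain_matrix z F) ^^ k) (input_matrix z F i0 *v axis i 1) =
    (if i = i0 then z ^ Suc k *\<^sub>R state_indicator (layer F (Input i0) (Suc k)) else 0)"
proof (cases "i = i0")
  case False
  have "input_matrix z F i0 *v axis i 1 = 0"
    using False by (simp add: matrix_vector_mult_basis column_def input_matrix_def vec_eq_iff)
  moreover have "((*v) (gain_matrix z F) ^^ k) 0 = 0" by (rule linear_0[OF linear_matrix_iterate])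
  ultimately show ?thesis using False by simp
next
  case True
  have "((*v) (gain_matrix z F) ^^ k) (input_matrix z F i0 *v axis i0 1) =
      z ^ Suc k *\<^sub>R state_indicator (layer F (Input i0) (Suc k))"
  proof (induction k)
    case 0
    show ?case
      by (simp add: matrix_vector_mult_basis column_def input_matrix_def vec_eq_iff
          state_indicator_def layer_Suc)
  next
    case (Suc k)
    let ?L = "layer F (Input i0) (Suc k)"
    have step: "gain_matrix z F *v state_indicator ?L = z *\<^sub>R state_indicator (F `` ?L)"
    proof (rule vec_eq_iff[THEN iffD2], rule allI)
      fix j
      have "(gain_matrix z F *v state_indicator ?L) $ j =
          (\<Sum>l\<in>UNIV. (if (State l, State j) \<in> F then z else 0) * (if State l \<in> ?L then 1 else 0))"
        by (simp add: matrix_vector_mult_def gain_matrix_def state_indicator_def)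
      also have "\<dots> = (if State j \<in> F `` ?L then z else 0)"
      proof (cases "State j \<in> F `` ?L")
        case True
        then obtain u where u: "u \<in> ?L" "(u, State j) \<in> F" by blast
        \<comment> \<open>Layers of positive index contain states only, since inputs have no
          incoming edge; the product with the gain matrix therefore misses no predecessor.\<close>
        have "\<nexists>i. u = Input i" using u(1) no_in by (auto simp: layer_Suc)
        then obtain l where l: "u = State l" by (cases u) auto
        have uniq: "l' = l" if "State l' \<in> ?L" "(State l', State j) \<in> F" for l'
        proof -
          have "State l' = u"
            using un[unfolded unambiguous_def, rule_format, OF that(1) u(1) that(2) u(2)] .
          then show ?thesis by (simp add: l)
        qed
        have "(if (State l', State j) \<in> F then z else 0) * (if State l' \<in> ?L then 1 else 0) =
            (if l' = l then z else 0)" for l'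
        proof (cases "l' = l")
          case True
          then show ?thesis using u l by simp
        next
          case False
          then have "State l' \<notin> ?L \<or> (State l', State j) \<notin> F" using uniq[of l'] by blast
          then show ?thesis using False by auto
        qed
        then show ?thesis using True by (simp only: sum.delta finite UNIV_I if_True)
      next
        case False
        then have "(if (State l, State j) \<in> F then z else 0) * (if State l \<in> ?L then 1 else 0) = 0" for l
          by auto
        then show ?thesis using False by (simp only: sum.neutral_const if_False)
      qed
      finally show "(gain_matrix z F *v state_indicator ?L) $ j = (z *\<^sub>R state_indicator (F `` ?L)) $ j"
        by (simp add: state_indicator_def)
    qed
    have "((*v) (gain_matrix z F) ^^ Suc k) (input_matrix z F i0 *v axis i0 1) =
        gain_matrix z F *v (z ^ Suc k *\<^sub>R state_indicator ?L)"
      by (simp only: funpow.simps o_apply Suc)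
    also have "\<dots> = z ^ Suc k *\<^sub>R (z *\<^sub>R state_indicator (F `` ?L))"
      by (simp only: matrix_vector_mult_scaleR step)
    finally show ?case by (simp add: layer_Suc[of F _ "Suc k"] mult.commute)
  qed
  with True show ?thesis by simp
qed

text \<open>A sum of indicators, so that measurability and integration are termwise. Points outside
  all pieces get 0 and contribute nothing to the moments.\<close>

definition piecewise :: "('n \<Rightarrow> 'a set) \<Rightarrow> ('n::finite \<Rightarrow> 'v) \<Rightarrow> 'a \<Rightarrow> 'v::real_vector" where
  "piecewise P c \<sigma> = (\<Sum>h\<in>UNIV. indicat_real (P h) \<sigma> *\<^sub>R c h)"

lemma piecewise_eq:
  assumes "disjoint_family P" "\<sigma> \<in> P h"
  shows "piecewise P c \<sigma> = c h"
proof -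
  have "indicat_real (P h') \<sigma> *\<^sub>R c h' = (if h' = h then c h else 0)" for h'
    using assms by (auto simp: disjoint_family_on_def indicator_def)
  then show ?thesis by (simp add: piecewise_def)
qed

lemma piecewise_eq_0:
  assumes "\<And>h. \<sigma> \<notin> P h"
  shows "piecewise P c \<sigma> = 0"
  using assms by (simp add: piecewise_def)

lemma piecewise_Linfty:
  fixes c :: "'n::finite \<Rightarrow> 'v::{real_normed_vector, second_countable_topology}"
  assumes "\<And>h. P h \<in> sets M"
  shows "piecewise P c \<in> Linfty M"
proof -
  have "piecewise P c \<in> borel_measurable M"
    unfolding piecewise_def[abs_def] using assms by measurable
  moreover have "norm (piecewise P c \<sigma>) \<le> (\<Sum>h\<in>UNIV. norm (c h))" for \<sigma>
  proof -
    have "norm (indicat_real (P h) \<sigma> *\<^sub>R c h) \<le> norm (c h)" for h by (simp add: indicator_def)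
    then show ?thesis unfolding piecewise_def by (intro sum_norm_le)
  qed
  ultimately show ?thesis unfolding Linfty_def by blast
qed

text \<open>On each piece the pair is constant, so its iterates are piecewise constant for the same
  family, and each piece enters with its probability as weight.\<close>

lemma (in prob_space) moment_piecewise:
  fixes a :: "'h::finite \<Rightarrow> real ^ 'n ^ 'n" and b :: "'h \<Rightarrow> real ^ 'm ^ 'n"
  assumes disj: "disjoint_family P" and meas: "\<And>h. P h \<in> sets M"
  shows "moment M (piecewise P a) (piecewise P b) k i =
    (\<Sum>h\<in>UNIV. prob (P h) *\<^sub>R ((*v) (a h) ^^ k) (b h *v axis i 1))"
proof -
  let ?c = "\<lambda>h. ((*v) (a h) ^^ k) (b h *v axis i 1)"
  have eq: "((*v) (piecewise P a \<sigma>) ^^ k) (piecewise P b \<sigma> *v axis i 1) = piecewise P ?c \<sigma>" for \<sigma>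
  proof (cases "\<exists>h. \<sigma> \<in> P h")
    case True
    then obtain h where h: "\<sigma> \<in> P h" by blast
    show ?thesis by (simp only: piecewise_eq[OF disj h])
  next
    case False
    then have notin: "\<sigma> \<notin> P h" for h by blast
    show ?thesis
      by (simp only: piecewise_eq_0[OF notin] matrix_vector_mult_0 linear_0[OF linear_matrix_iterate])
  qed
  have int: "integrable M (\<lambda>\<sigma>. indicat_real (P h) \<sigma> *\<^sub>R ?c h)" for h
    using meas[of h] by (intro integrable_scaleR_left integrable_real_indicator) (auto simp: emeasure_eq_measure)
  have "moment M (piecewise P a) (piecewise P b) k i =
      (\<integral>\<sigma>. (\<Sum>h\<in>UNIV. indicat_real (P h) \<sigma> *\<^sub>R ?c h) \<partial>M)"
    unfolding moment_def eq by (simp only: piecewise_def)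
  also have "\<dots> = (\<Sum>h\<in>UNIV. (\<integral>\<sigma>. indicat_real (P h) \<sigma> *\<^sub>R ?c h \<partial>M))"
    using int by (rule Bochner_Integration.integral_sum)
  also have "\<dots> = (\<Sum>h\<in>UNIV. prob (P h) *\<^sub>R ?c h)"
  proof (rule sum.cong[OF refl])
    fix h
    have "(\<integral>\<sigma>. indicat_real (P h) \<sigma> *\<^sub>R ?c h \<partial>M) = (\<integral>\<sigma>. indicat_real (P h) \<sigma> \<partial>M) *\<^sub>R ?c h"
      by (intro integral_scaleR_left) (use meas[of h] in \<open>auto simp: emeasure_eq_measure intro!: integrable_real_indicator\<close>)
    also have "(\<integral>\<sigma>. indicat_real (P h) \<sigma> \<partial>M) = prob (P h)"
      using meas[of h] sets.sets_into_space[OF meas[of h]] by (simp add: Int_absorb2)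
    finally show "(\<integral>\<sigma>. indicat_real (P h) \<sigma> *\<^sub>R ?c h \<partial>M) = prob (P h) *\<^sub>R ?c h" .
  qed
  finally show ?thesis .
qed

text \<open>Ties of \<open>g\<close> are broken by an enumeration, in lexicographic order. They do
  occur: all pieces outside the core get the same \<open>g\<close>, yet the argument for long walks
  needs distinct ranks.\<close>

lemma rank_refining:
  fixes g :: "'n::finite \<Rightarrow> nat"
  shows "\<exists>r :: 'n \<Rightarrow> nat. inj r \<and> (\<forall>h h'. g h < g h' \<longrightarrow> r h < r h')"
proof -
  obtain e where e: "bij_betw e (UNIV :: 'n set) {0..<CARD('n)}"
    using ex_bij_betw_finite_nat[of "UNIV :: 'n set"] by auto
  have lt: "e h < CARD('n)" for h using bij_betwE[OF e] by auto
  let ?r = "\<lambda>h. g h * CARD('n) + e h"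
  have mono: "?r h < ?r h'" if "g h < g h'" for h h'
  proof -
    have "?r h < Suc (g h) * CARD('n)" using lt[of h] by simp
    also have "\<dots> \<le> g h' * CARD('n)" using that by (intro mult_right_mono) auto
    finally show ?thesis by simp
  qed
  have "inj ?r"
  proof (rule injI)
    fix h h' assume eq: "?r h = ?r h'"
    then have "g h = g h'" using mono[of h h'] mono[of h' h] by linarith
    with eq have "e h = e h'" by simp
    then show "h = h'" using bij_betw_imp_inj_on[OF e] by (simp add: inj_eq)
  qed
  with mono show ?thesis by (intro exI[of _ ?r]) simp
qed

lemma (in prob_space) structurally_averaged_controllableI:
  fixes G :: "('n::finite, 'm::finite) node pair_pre_digraph" and P :: "'n \<Rightarrow> 'a set"
  assumes G: "G \<in> control_digraphs" and acc: "accessible G"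
    and match: "has_row_saturating_matching (pattern_rows G) (pattern_columns G) (sparsity_pattern G)"
    and disj: "disjoint_family P" and meas: "\<And>h. P h \<in> sets M" and pos: "\<And>h. 0 < prob (P h)"
  shows "structurally_averaged_controllable M G"
proof -
  define R where "R = parcs G"
  define C where "C = core_states G"
  have no_in: "(u, Input i) \<notin> R" for u i using G by (simp add: control_digraphs_def R_def)
  have C_iff: "h \<in> C \<longleftrightarrow> (\<nexists>c. (c, c) \<in> R\<^sup>+ \<and> (c, State h) \<in> R\<^sup>*)" for h
    unfolding C_def R_def by (rule core_states_iff[OF G])
  obtain c where c: "inj_on c C" "\<And>h. h \<in> C \<Longrightarrow> (Input (snd (c h)), State h) \<in> R ^^ fst (c h)"
    using match unfolding row_saturating_matching_iff[OF G finite] C_def R_def by blast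
  \<comment> \<open>Accessibility speaks of states; a cyclic node is one because inputs have no
    incoming edges.\<close>
  have access: "\<exists>x\<in>range Input. (x, v) \<in> R\<^sup>*" if v: "(v, v) \<in> R\<^sup>+" for v
  proof -
    obtain j where j: "v = State j"
    proof (cases v)
      case (Input i)
      with v no_in show thesis by (metis tranclE)
    qed (use that in blast)
    obtain i where "(Input i, State j) \<in> R\<^sup>*"
      using acc unfolding accessible_iff[OF G] R_def by blast
    with j show ?thesis by blast
  qed
  have ex_core: "\<exists>F i. F \<subseteq> R \<and> unambiguous F (Input i) \<and> i = snd (c h) \<and>
      layer F (Input i) (fst (c h)) = {State h} \<and> (\<forall>k>fst (c h). layer F (Input i) k = {})"
    if h: "h \<in> C" for h
  proof -
    have nc: "(v, State h) \<notin> R\<^sup>*" if "(v, v) \<in> R\<^sup>+" for v using h that unfolding C_iff by blast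
    show ?thesis
    proof (rule path_subgraph[OF c(2)[OF h] nc])
      fix F
      assume "F \<subseteq> R" "unambiguous F (Input (snd (c h)))"
        "layer F (Input (snd (c h))) (fst (c h)) = {State h}"
        "\<And>k. fst (c h) < k \<Longrightarrow> layer F (Input (snd (c h))) k = {}"
      then show ?thesis by (intro exI[of _ F] exI[of _ "snd (c h)"]) simp
    qed
  qed
  have ex_rec: "\<exists>F i. F \<subseteq> R \<and> unambiguous F (Input i) \<and> (\<forall>K. \<exists>k\<ge>K. State h \<in> layer F (Input i) k \<and>
       (\<forall>u\<in>layer F (Input i) k. u \<noteq> State h \<longrightarrow>
          (\<exists>c. (c, c) \<in> R\<^sup>+ \<and> (c, u) \<in> R\<^sup>*) \<and> cyc_dist R u < cyc_dist R (State h)))"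
    if h: "h \<notin> C" for h
  proof -
    obtain v where v: "(v, v) \<in> R\<^sup>+" "(v, State h) \<in> R\<^sup>*" using h unfolding C_iff by blast
    show ?thesis
    proof (rule recurrent_subgraph[OF access v])
      fix x F
      assume x: "x \<in> range Input" "F \<subseteq> R" "unambiguous F x"
        "\<And>K. \<exists>k\<ge>K. State h \<in> layer F x k \<and> (\<forall>u\<in>layer F x k. u \<noteq> State h \<longrightarrow>
          (\<exists>c. (c, c) \<in> R\<^sup>+ \<and> (c, u) \<in> R\<^sup>*) \<and> cyc_dist R u < cyc_dist R (State h))"
      from x(1) obtain i where i: "x = Input i" by blast
      show ?thesis
        by (intro exI[of _ F] exI[of _ i] conjI allI x(2) x(3)[unfolded i] x(4)[unfolded i])
    qed
  qed
  have "\<forall>h. \<exists>Fi. fst Fi \<subseteq> R \<and> unambiguous (fst Fi) (Input (snd Fi)) \<and>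
      (h \<in> C \<longrightarrow> snd Fi = snd (c h) \<and> layer (fst Fi) (Input (snd Fi)) (fst (c h)) = {State h} \<and>
        (\<forall>k>fst (c h). layer (fst Fi) (Input (snd Fi)) k = {})) \<and>
      (h \<notin> C \<longrightarrow> (\<forall>K. \<exists>k\<ge>K. State h \<in> layer (fst Fi) (Input (snd Fi)) k \<and>
       (\<forall>u\<in>layer (fst Fi) (Input (snd Fi)) k. u \<noteq> State h \<longrightarrow>
          (\<exists>c. (c, c) \<in> R\<^sup>+ \<and> (c, u) \<in> R\<^sup>*) \<and> cyc_dist R u < cyc_dist R (State h))))"
    (is "\<forall>h. \<exists>Fi. ?Q h Fi")
  proof
    fix h
    show "\<exists>Fi. ?Q h Fi"
    proof (cases "h \<in> C")
      case True
      from ex_core[OF True] obtain F i where "F \<subseteq> R" "unambiguous F (Input i)" "i = snd (c h)"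
        "layer F (Input i) (fst (c h)) = {State h}" "\<forall>k>fst (c h). layer F (Input i) k = {}" by blast
      with True show ?thesis by (intro exI[of _ "(F, i)"]) simp
    next
      case False
      from ex_rec[OF False] obtain F i where "F \<subseteq> R" "unambiguous F (Input i)"
        "\<forall>K. \<exists>k\<ge>K. State h \<in> layer F (Input i) k \<and> (\<forall>u\<in>layer F (Input i) k. u \<noteq> State h \<longrightarrow>
          (\<exists>c. (c, c) \<in> R\<^sup>+ \<and> (c, u) \<in> R\<^sup>*) \<and> cyc_dist R u < cyc_dist R (State h))" by blast
      with False show ?thesis by (intro exI[of _ "(F, i)"]) simp
    qed
  qed
  from choice[OF this] obtain Fi where Fi: "\<forall>h. ?Q h (Fi h)" by blast
  define F where "F h = fst (Fi h)" for h
  define inp where "inp h = snd (Fi h)" for h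
  note Fi_h = spec[OF Fi, folded F_def inp_def]
  have F: "F h \<subseteq> R" "unambiguous (F h) (Input (inp h))" for h
    using Fi_h[of h] by (simp_all only: simp_thms)
  define S where "S h k = {j. State j \<in> layer (F h) (Input (inp h)) k}" for h k
  define len where "len h = fst (c h)" for h
  have inp_core: "inp h = snd (c h)" and layer_len: "layer (F h) (Input (inp h)) (len h) = {State h}"
    and layer_empty: "\<forall>k>len h. layer (F h) (Input (inp h)) k = {}" if "h \<in> C" for h
    using Fi_h[of h] that unfolding len_def by fast+
  have layer_rec: "\<exists>k\<ge>K. State h \<in> layer (F h) (Input (inp h)) k \<and>
      (\<forall>u\<in>layer (F h) (Input (inp h)) k. u \<noteq> State h \<longrightarrow>
        (\<exists>c. (c, c) \<in> R\<^sup>+ \<and> (c, u) \<in> R\<^sup>*) \<and> cyc_dist R u < cyc_dist R (State h))"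
    if "h \<notin> C" for h K
    using Fi_h[of h] that by (simp only: simp_thms)
  define \<delta> where "\<delta> h = cyc_dist R (State h)" for h :: 'n
  \<comment> \<open>The successor puts all core pieces above the others, and the subtraction puts
    shorter paths above longer ones.\<close>
  define g where "g h = (if h \<in> C then Suc (Max (range len) - len h) else 0)" for h
  obtain r :: "'n \<Rightarrow> nat" where r: "inj r" "\<And>h h'. g h < g h' \<Longrightarrow> r h < r h'" using rank_refining[of g] by blast
  define pmin where "pmin = Min (range (\<lambda>h. prob (P h)))"
  have pmin: "0 < pmin" "\<And>h. pmin \<le> prob (P h)" using pos by (auto simp: pmin_def Min_gr_iff)
  \<comment> \<open>The quotient makes the gain outweigh even the least probable piece:
    \<open>prob (P h) * Z\<close> exceeds the number of states. The 2 gives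
    \<open>1 < Z\<close>.\<close>
  define Z where "Z = max 2 ((real CARD('n) + 1) / pmin)"
  have Z1: "1 < Z" by (simp add: Z_def)
  have Z2: "CARD('n) < prob (P h) * Z" for h
  proof -
    have "real CARD('n) < pmin * ((real CARD('n) + 1) / pmin)" using pmin(1) by simp
    also have "\<dots> \<le> prob (P h) * Z"
      using pmin less_imp_le[OF pmin(1)] by (intro mult_mono) (auto simp: Z_def)
    finally show ?thesis .
  qed
  have psum: "(\<Sum>h\<in>UNIV. prob (P h)) \<le> 1"
  proof -
    have "(\<Sum>h\<in>UNIV. prob (P h)) = prob (\<Union>h\<in>UNIV. P h)"
      using disj meas by (intro finite_measure_finite_Union[symmetric]) auto
    then show ?thesis by simp
  qed
  define A where "A = piecewise P (\<lambda>h. gain_matrix (Z ^ r h) (F h))"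
  define B where "B = piecewise P (\<lambda>h. input_matrix (Z ^ r h) (F h) (inp h))"
  have AB: "A \<in> Linfty M" "B \<in> Linfty M"
    using meas by (simp_all add: A_def B_def piecewise_Linfty)
  \<comment> \<open>The input edge and the k state edges each carry the gain \<open>Z ^ r h\<close>,
    whence the exponent \<open>r h * Suc k\<close>.\<close>
  have mom: "w \<bullet> moment M A B k i =
      (\<Sum>h | inp h = i. prob (P h) * Z ^ (r h * Suc k) * (\<Sum>v\<in>S h (Suc k). w $ v))" for w k i
  proof -
    have "moment M A B k i = (\<Sum>h\<in>UNIV. prob (P h) *\<^sub>R (if i = inp h
        then (Z ^ r h) ^ Suc k *\<^sub>R state_indicator (layer (F h) (Input (inp h)) (Suc k)) else 0))"
      unfolding A_def B_def moment_piecewise[OF disj meas]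
      using F(1) no_in by (intro sum.cong refl arg_cong2[of _ _ _ _ scaleR] iterate_gain_matrix F(2)) blast
    also have "w \<bullet> \<dots> = (\<Sum>h\<in>UNIV. if inp h = i then prob (P h) * Z ^ (r h * Suc k) * (\<Sum>v\<in>S h (Suc k). w $ v) else 0)"
      unfolding inner_sum_right
    proof (rule sum.cong[OF refl])
      fix h
      have "w \<bullet> state_indicator (layer (F h) (Input (inp h)) (Suc k)) = (\<Sum>v\<in>UNIV. if v \<in> S h (Suc k) then w $ v else 0)"
        unfolding inner_vec_def by (intro sum.cong) (auto simp: state_indicator_def S_def)
      also have "\<dots> = (\<Sum>v\<in>S h (Suc k). w $ v)" by (simp add: sum.If_cases)
      finally have "w \<bullet> state_indicator (layer (F h) (Input (inp h)) (Suc k)) = (\<Sum>v\<in>S h (Suc k). w $ v)" .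
      then show "w \<bullet> (prob (P h) *\<^sub>R (if i = inp h
        then (Z ^ r h) ^ Suc k *\<^sub>R state_indicator (layer (F h) (Input (inp h)) (Suc k)) else 0)) =
        (if inp h = i then prob (P h) * Z ^ (r h * Suc k) * (\<Sum>v\<in>S h (Suc k). w $ v) else 0)"
        by (cases "i = inp h") (simp_all only: inner_scaleR_right power_mult mult.assoc inner_zero_right
            mult_zero_right if_True if_False simp_thms eq_commute[of _ i])
    qed
    finally show ?thesis by (simp add: sum.If_cases)
  qed
  have "averaged_controllable M A B"
  proof (rule averaged_controllableI[OF AB])
    fix w :: "real ^ 'n" assume w: "\<And>k i. w \<bullet> moment M A B k i = 0"
    have "w $ v = 0" for v
    proof (rule separated_gains_imp_zero[where S = S and C = C and len = len and inp = inp and r = r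
          and \<delta> = \<delta> and Z = Z and p = "\<lambda>h. prob (P h)" and w = "\<lambda>v. w $ v"])
      show "S h (len h) = {h}" if "h \<in> C" for h
        by (simp add: S_def layer_len[OF that])
      show "S h k = {}" if "h \<in> C" "len h < k" for h k
        using layer_empty[OF that(1)] that(2) by (simp add: S_def)
      show "1 \<le> len h" if "h \<in> C" for h
        using core_walk_length(1)[OF G finite _ c(2)[OF that, unfolded R_def]] that
        by (simp add: C_def len_def)
      show "h = h'" if "h \<in> C" "h' \<in> C" "inp h = inp h'" "len h = len h'" for h h'
        using inj_onD[OF c(1) _ that(1,2)] that by (simp add: inp_core len_def prod_eq_iff)
      show "\<exists>k\<ge>K. h \<in> S h k \<and> (\<forall>v\<in>S h k. v \<noteq> h \<longrightarrow> v \<notin> C \<and> \<delta> v < \<delta> h)" if h: "h \<notin> C" for h K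
      proof -
        from layer_rec[OF h] obtain k where k: "K \<le> k" "State h \<in> layer (F h) (Input (inp h)) k"
          "\<forall>u\<in>layer (F h) (Input (inp h)) k. u \<noteq> State h \<longrightarrow>
            (\<exists>c. (c, c) \<in> R\<^sup>+ \<and> (c, u) \<in> R\<^sup>*) \<and> cyc_dist R u < cyc_dist R (State h)"
          by blast
        have "v \<notin> C \<and> \<delta> v < \<delta> h" if "v \<in> S h k" "v \<noteq> h" for v
          using bspec[OF k(3), of "State v"] that unfolding S_def C_iff \<delta>_def by simp
        with k(1,2) show ?thesis by (intro exI[of _ k]) (simp add: S_def)
      qed
      show "r h' < r h" if "h \<in> C" "h' \<notin> C" for h h' using that by (intro r(2)) (simp add: g_def)
      show "r h' < r h" if "h \<in> C" "h' \<in> C" "len h < len h'" for h h'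
      proof (rule r(2))
        have "len h' \<le> Max (range len)" by (rule Max_ge) auto
        with that(3) have "Max (range len) - len h' < Max (range len) - len h" by linarith
        with that(1,2) show "g h' < g h" by (simp add: g_def)
      qed
      \<comment> \<open>Walks of k edges are seen by the moment of index k - 1.\<close>
      show "(\<Sum>h | inp h = i. prob (P h) * Z ^ (r h * k) * (\<Sum>v\<in>S h k. w $ v)) = 0" if "1 \<le> k" for k i
        using mom[of w "k - 1" i] w[of "k - 1" i] that by simp
    qed (use r(1) pos psum Z1 Z2 in auto)
    then show "w = 0" by (simp add: vec_eq_iff)
  qed
  moreover have "compliant M G A B"
    unfolding compliant_def
  proof (intro conjI AB allI impI AE_I2)
    fix j k \<sigma> assume "(State k, State j) \<notin> parcs G"
    then have "gain_matrix (Z ^ r h) (F h) $ j $ k = 0" for h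
      using F(1)[of h] by (auto simp: gain_matrix_def R_def)
    then show "A \<sigma> $ j $ k = 0" by (simp add: A_def piecewise_def)
  next
    fix j i \<sigma> assume "(Input i, State j) \<notin> parcs G"
    then have "input_matrix (Z ^ r h) (F h) (inp h) $ j $ i = 0" for h
      using F(1)[of h] by (auto simp: input_matrix_def R_def)
    then show "B \<sigma> $ j $ i = 0" by (simp add: B_def piecewise_def)
  qed
  ultimately show ?thesis unfolding structurally_averaged_controllable_def by blast
qed

theorem theorem3p7:
  fixes \<A> :: "('a::{second_countable_topology, t2_space} set \<times> ('a \<Rightarrow> real ^ 'd)) set"
    and \<mu> \<nu> :: "'a measure"
    and W :: "'a set"
    and G :: "('n::finite, 'm::finite) node pair_pre_digraph"
  assumes "smooth_atlas \<A>"
    and "prob_space \<mu>" and "sets \<mu> = sets borel"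
    and "open W" and "W \<noteq> {}" and "W \<subseteq> measure_support \<mu>"
    and "smooth_volume_measure \<A> W \<nu>"
    and "absolutely_continuous \<nu> (restrict_space \<mu> W)"
    and "G \<in> control_digraphs"
  shows "structurally_averaged_controllable \<mu> G \<longleftrightarrow>
    accessible G \<and>
    has_row_saturating_matching (pattern_rows G) (pattern_columns G) (sparsity_pattern G)"
proof
  interpret prob_space \<mu> by fact
  {
    assume "structurally_averaged_controllable \<mu> G"
    from structurally_averaged_controllableD[OF assms(9) this]
    show "accessible G \<and>
      has_row_saturating_matching (pattern_rows G) (pattern_columns G) (sparsity_pattern G)" by blast
  next
    assume am: "accessible G \<and>
      has_row_saturating_matching (pattern_rows G) (pattern_columns G) (sparsity_pattern G)"
    have Wm: "W \<in> sets \<mu>" using assms(3,4) by simp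
    have W0: "emeasure \<mu> W \<noteq> 0"
    proof -
      obtain x where x: "x \<in> W" using assms(5) by blast
      then have "x \<in> measure_support \<mu>" using assms(6) by blast
      then have "0 < emeasure \<mu> W" using assms(4) x by (simp add: measure_support_def)
      then show ?thesis by simp
    qed
    \<comment> \<open>Points of \<open>W\<close> are null for the volume measure, and absolute
      continuity passes this on to the restriction of \<mu> to \<open>W\<close>.\<close>
    have null: "emeasure \<mu> {x} = 0" if x: "x \<in> W" for x
    proof -
      have "{x} \<in> null_sets (restrict_space \<mu> W)"
        using smooth_volume_measure_singleton[OF assms(1,4,7) x] assms(8)
        unfolding absolutely_continuous_def by blast
      then show ?thesis using null_sets_restrict_space[OF Wm] by auto
    qed
    obtain P :: "'n \<Rightarrow> 'a set" where P: "disjoint_family P"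
        "\<And>h. P h \<in> sets \<mu>" "\<And>h. emeasure \<mu> (P h) \<noteq> 0"
    proof -
      from disjoint_positive_sets[OF assms(3) Wm W0 null finite[of "UNIV :: 'n set"]]
      obtain P :: "'n \<Rightarrow> 'a set" where "disjoint_family P"
        "\<forall>i\<in>UNIV. P i \<in> sets \<mu> \<and> P i \<subseteq> W \<and> emeasure \<mu> (P i) \<noteq> 0" by blast
      then show thesis by (intro that[of P]) simp_all
    qed
    have "0 < prob (P h)" for h
      using P(3)[of h] by (simp add: emeasure_eq_measure zero_less_measure_iff)
    from structurally_averaged_controllableI[OF assms(9) conjunct1[OF am] conjunct2[OF am] P(1,2) this]
    show "structurally_averaged_controllable \<mu> G" .
  }
qed

end
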